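(* Let $X\subset\mathbb{R}^n$ be a non-empty semi-monotone set and $f_1:X\to\mathbb{R}$ a continuous bounded function. The map $\mathbf{f}=(f_1):X\to\mathbb{R}^1$ is a monotone map if and only if the function $f_1$ is a monotone function.
   Context: Fix an o-minimal structure over $\mathbb{R}$; all sets and maps are definable. The empty set is connected. A coordinate cone in $\mathbb{R}^N$ is a set $\{z\mid z_{j_1}\sigma_1c_1,\dots,z_{j_m}\sigma_mc_m\}$ ($0\le m\le N$, distinct indices, $\sigma_i\in\{<,=,>\}$, $c_i\in\mathbb{R}$). A set is semi-monotone if it is open, bounded, definable and meets every coordinate cone in a connected set. A definable $f$ on open $X\subset\mathbb{R}^n$ is strictly increasing/decreasing in $x_j$ if $f(\mathbf{x})<f(\mathbf{y})$ / $f(\mathbf{x})>f(\mathbf{y})$ whenever $\mathbf{x},\mathbf{y}\in X$ differ only in coordinate $j$ with $x_j<y_j$, and independent of $x_j$ if $f(\mathbf{x})=f(\mathbf{y})$ for such pairs. A bounded upper semicontinuous $f$ on non-empty semi-monotone $X$ is submonotone if all $\{f<b\}$ are semi-monotone, supermonotone if $-f$ is submonotone; $f$ is a monotone function if it is sub- and supermonotone and for each $j$ strictly increasing in, strictly decreasing in, or independent of $x_j$. For $X\subset\mathbb{R}^n$ non-empty semi-monotone and $\mathbf{f}=(f_1,\dots,f_k):X\to\mathbb{R}^k$ continuous bounded with graph $\mathbf{F}$ (coordinates $x_1,\dots,x_n,y_1,\dots,y_k$), a set $\{x_{j_1},\dots,x_{j_\alpha},y_{i_1},\dots,y_{i_\beta}\}$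 with $\alpha+\beta=n$ is a basis set if $(x_{j_1},\dots,x_{j_\alpha},f_{i_1},\dots,f_{i_\beta}):X\to\mathbb{R}^n$ is injective. $\mathbf{f}$ is a monotone map, by induction on $n$: for $n=1$ if each $f_i$ is a monotone function; for $n>1$ if for all $i,j$ with $f_i$ not independent of $x_j$: (i) each non-empty $\mathbf{F}\cap\{y_i=b\}$ (viewed in the coordinates other than $y_i$) is the graph of a monotone map $\mathbf{f}_{i,j,b}$ from a semi-monotone subset of the span of $\{x_1,\dots,x_n\}\setminus\{x_j\}$ to the span of $y_1,\dots,y_{i-1},x_j,y_{i+1},\dots,y_k$; (ii) the system of basis sets of $\mathbf{f}_{i,j,b}$ is independent of $b$. *)

theory Defs
  imports "HOL-Analysis.Analysis"
begin

text \<open>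
  An o-minimal structure on the ordered set of real numbers, in the sense of van den Dries.
  Points of the \<open>m\<close>-th Cartesian power are lists of length \<open>m\<close>, and \<open>S m\<close> is the collection of
  definable subsets of that power.  Parameters are allowed (by \<open>ominimal\<close> all singletons are in
  \<open>S 1\<close>).  The field operations need not be definable, but they may be: o-minimal expansions of
  the real field are the special case in which \<open>S 3\<close> contains the graphs of \<open>+\<close> and \<open>*\<close>.
\<close>
locale o_minimal_structure =
  fixes S :: "nat \<Rightarrow> real list set set"
  assumes subset_power: "A \<in> S m \<Longrightarrow> A \<subseteq> {xs. length xs = m}"
    and empty: "{} \<in> S m"
    and union: "A \<in> S m \<Longrightarrow> B \<in> S m \<Longrightarrow> A \<union> B \<in> S m"
    and complement: "A \<in> S m \<Longrightarrow> {xs. length xs = m} - A \<in> S m"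
    and cylinder_left: "A \<in> S m \<Longrightarrow> {x # xs | x xs. xs \<in> A} \<in> S (Suc m)"
    and cylinder_right: "A \<in> S m \<Longrightarrow> {xs @ [x] | x xs. xs \<in> A} \<in> S (Suc m)"
    and diagonal: "m \<ge> 1 \<Longrightarrow> {xs. length xs = m \<and> hd xs = last xs} \<in> S m"
    and projection: "A \<in> S (Suc m) \<Longrightarrow> butlast ` A \<in> S m"
    and less: "{[x, y] | x y. x < y} \<in> S 2"
    and ominimal: "S 1 = {(\<lambda>x. [x]) ` \<Union>\<I> | \<I>. finite \<I> \<and> (\<forall>J\<in>\<I>. is_interval J)}"

text \<open>
  Coordinates are labelled by natural numbers.  The span of a finite set \<open>I\<close> of coordinates is
  \<open>PiE I (\<lambda>_. UNIV)\<close>, with topology \<^term>\<open>powertop_real I\<close>.  Keeping the labels makes it possible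
  to delete a coordinate, or to turn an argument coordinate into a value coordinate, without
  renumbering the others.
\<close>

abbreviation span_of :: "nat set \<Rightarrow> (nat \<Rightarrow> real) set" where
  "span_of I \<equiv> PiE I (\<lambda>_. UNIV)"

text \<open>Definability in the span of \<open>I\<close> refers to the coordinates listed in increasing order.\<close>
definition definable :: "(nat \<Rightarrow> real list set set) \<Rightarrow> nat set \<Rightarrow> (nat \<Rightarrow> real) set \<Rightarrow> bool" where
  "definable S I A \<longleftrightarrow>
     A \<subseteq> span_of I \<and> (\<lambda>z. map z (sorted_list_of_set I)) ` A \<in> S (card I)"

definition definable_function ::
    "(nat \<Rightarrow> real list set set) \<Rightarrow> nat set \<Rightarrow> (nat \<Rightarrow> real) set \<Rightarrow> ((nat \<Rightarrow> real) \<Rightarrow> real) \<Rightarrow> bool" where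
  "definable_function S I X f \<longleftrightarrow>
     (\<lambda>x. map x (sorted_list_of_set I) @ [f x]) ` X \<in> S (Suc (card I))"

text \<open>
  The common bound on the coordinates is spelled out because the library's metric on
  \<^typ>\<open>nat \<Rightarrow> real\<close> makes every set bounded.
\<close>
definition bounded_in_span :: "nat set \<Rightarrow> (nat \<Rightarrow> real) set \<Rightarrow> bool" where
  "bounded_in_span I A \<longleftrightarrow> (\<exists>B. \<forall>z\<in>A. \<forall>i\<in>I. \<bar>z i\<bar> \<le> B)"

text \<open>At most one condition per coordinate: the indices \<open>j\<^sub>1, \<dots>, j\<^sub>m\<close> form the set \<open>J\<close>.\<close>
definition coordinate_cone :: "nat set \<Rightarrow> (nat \<Rightarrow> real) set \<Rightarrow> bool" where
  "coordinate_cone I C \<longleftrightarrow>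
     (\<exists>J (\<sigma> :: nat \<Rightarrow> real \<Rightarrow> real \<Rightarrow> bool) c.
        J \<subseteq> I \<and> (\<forall>j\<in>J. \<sigma> j \<in> {(<), (=), (>)}) \<and>
        C = {z \<in> span_of I. \<forall>j\<in>J. \<sigma> j (z j) (c j)})"

definition semi_monotone :: "(nat \<Rightarrow> real list set set) \<Rightarrow> nat set \<Rightarrow> (nat \<Rightarrow> real) set \<Rightarrow> bool" where
  "semi_monotone S I X \<longleftrightarrow>
     openin (powertop_real I) X \<and> bounded_in_span I X \<and> definable S I X \<and>
     (\<forall>C. coordinate_cone I C \<longrightarrow> connectedin (powertop_real I) (X \<inter> C))"

definition strictly_increasing_in ::
    "nat set \<Rightarrow> (nat \<Rightarrow> real) set \<Rightarrow> ((nat \<Rightarrow> real) \<Rightarrow> real) \<Rightarrow> nat \<Rightarrow> bool" where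
  "strictly_increasing_in I X f j \<longleftrightarrow>
     (\<forall>x\<in>X. \<forall>y\<in>X. (\<forall>i\<in>I - {j}. x i = y i) \<and> x j < y j \<longrightarrow> f x < f y)"

definition strictly_decreasing_in ::
    "nat set \<Rightarrow> (nat \<Rightarrow> real) set \<Rightarrow> ((nat \<Rightarrow> real) \<Rightarrow> real) \<Rightarrow> nat \<Rightarrow> bool" where
  "strictly_decreasing_in I X f j \<longleftrightarrow>
     (\<forall>x\<in>X. \<forall>y\<in>X. (\<forall>i\<in>I - {j}. x i = y i) \<and> x j < y j \<longrightarrow> f x > f y)"

definition independent_of ::
    "nat set \<Rightarrow> (nat \<Rightarrow> real) set \<Rightarrow> ((nat \<Rightarrow> real) \<Rightarrow> real) \<Rightarrow> nat \<Rightarrow> bool" where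
  "independent_of I X f j \<longleftrightarrow>
     (\<forall>x\<in>X. \<forall>y\<in>X. (\<forall>i\<in>I - {j}. x i = y i) \<and> x j < y j \<longrightarrow> f x = f y)"

definition upper_semicontinuous_on ::
    "nat set \<Rightarrow> (nat \<Rightarrow> real) set \<Rightarrow> ((nat \<Rightarrow> real) \<Rightarrow> real) \<Rightarrow> bool" where
  "upper_semicontinuous_on I X f \<longleftrightarrow>
     (\<forall>b. openin (subtopology (powertop_real I) X) {x \<in> X. f x < b})"

text \<open>
  Definability of \<open>f\<close> itself is required in \<open>monotone_function\<close> below rather than here, because in a
  structure without addition \<open>- f\<close> need not be definable when \<open>f\<close> is.
\<close>
definition submonotone ::
    "(nat \<Rightarrow> real list set set) \<Rightarrow> nat set \<Rightarrow> (nat \<Rightarrow> real) set \<Rightarrow> ((nat \<Rightarrow> real) \<Rightarrow> real) \<Rightarrow> bool" where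
  "submonotone S I X f \<longleftrightarrow>
     semi_monotone S I X \<and> X \<noteq> {} \<and> bounded (f ` X) \<and> upper_semicontinuous_on I X f \<and>
     (\<forall>b. semi_monotone S I {x \<in> X. f x < b})"

definition supermonotone ::
    "(nat \<Rightarrow> real list set set) \<Rightarrow> nat set \<Rightarrow> (nat \<Rightarrow> real) set \<Rightarrow> ((nat \<Rightarrow> real) \<Rightarrow> real) \<Rightarrow> bool" where
  "supermonotone S I X f \<longleftrightarrow> submonotone S I X (\<lambda>x. - f x)"

definition monotone_function ::
    "(nat \<Rightarrow> real list set set) \<Rightarrow> nat set \<Rightarrow> (nat \<Rightarrow> real) set \<Rightarrow> ((nat \<Rightarrow> real) \<Rightarrow> real) \<Rightarrow> bool" where
  "monotone_function S I X f \<longleftrightarrow>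
     definable_function S I X f \<and> submonotone S I X f \<and> supermonotone S I X f \<and>
     (\<forall>j\<in>I. strictly_increasing_in I X f j \<or> strictly_decreasing_in I X f j \<or>
            independent_of I X f j)"

text \<open>
  In the following, \<open>I\<close> and \<open>K\<close> are the disjoint sets of argument and value coordinates of a map
  \<open>f\<close> from \<open>X \<subseteq> span_of I\<close> to \<open>span_of K\<close>.
\<close>

definition graph_of ::
    "nat set \<Rightarrow> nat set \<Rightarrow> (nat \<Rightarrow> real) set \<Rightarrow> ((nat \<Rightarrow> real) \<Rightarrow> nat \<Rightarrow> real) \<Rightarrow> (nat \<Rightarrow> real) set" where
  "graph_of I K X f = (\<lambda>x. merge I K (x, f x)) ` X"

text \<open>The set \<open>F \<inter> {z\<^sub>i = b}\<close>, viewed in the coordinates of \<open>L\<close> other than \<open>i\<close>.\<close>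
definition slice :: "nat set \<Rightarrow> nat \<Rightarrow> real \<Rightarrow> (nat \<Rightarrow> real) set \<Rightarrow> (nat \<Rightarrow> real) set" where
  "slice L i b F = (\<lambda>z. restrict z (L - {i})) ` {z \<in> F. z i = b}"

definition basis_sets ::
    "nat set \<Rightarrow> nat set \<Rightarrow> (nat \<Rightarrow> real) set \<Rightarrow> ((nat \<Rightarrow> real) \<Rightarrow> nat \<Rightarrow> real) \<Rightarrow> nat set set" where
  "basis_sets I K X f =
     {B. B \<subseteq> I \<union> K \<and> card B = card I \<and> inj_on (\<lambda>x. restrict (merge I K (x, f x)) B) X}"

text \<open>The standing assumptions on the maps among which the monotone ones are singled out.\<close>
definition admissible_map ::
    "(nat \<Rightarrow> real list set set) \<Rightarrow> nat set \<Rightarrow> nat set \<Rightarrow> (nat \<Rightarrow> real) set \<Rightarrow>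
     ((nat \<Rightarrow> real) \<Rightarrow> nat \<Rightarrow> real) \<Rightarrow> bool" where
  "admissible_map S I K X f \<longleftrightarrow>
     finite I \<and> finite K \<and> I \<inter> K = {} \<and>
     semi_monotone S I X \<and> X \<noteq> {} \<and>
     continuous_map (subtopology (powertop_real I) X) (powertop_real K) f \<and>
     bounded_in_span K (f ` X) \<and> definable S (I \<union> K) (graph_of I K X f)"

text \<open>
  The induction on the number \<open>card I\<close> of arguments is rendered as an inductive predicate: the
  recursive occurrence has one argument coordinate less.  The collection \<open>\<B>\<close> is the
  system of basis sets shared by the maps \<open>f\<^sub>i\<^sub>,\<^sub>j\<^sub>,\<^sub>b\<close> for all \<open>b\<close>.
\<close>
inductive monotone_map ::
    "(nat \<Rightarrow> real list set set) \<Rightarrow> nat set \<Rightarrow> nat set \<Rightarrow> (nat \<Rightarrow> real) set \<Rightarrow>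
     ((nat \<Rightarrow> real) \<Rightarrow> nat \<Rightarrow> real) \<Rightarrow> bool"
  for S :: "nat \<Rightarrow> real list set set" where
  one: "monotone_map S I K X f"
    if "card I = 1" "admissible_map S I K X f"
      "\<forall>i\<in>K. monotone_function S I X (\<lambda>x. f x i)"
| many: "monotone_map S I K X f"
    if "card I > 1" "admissible_map S I K X f"
      "\<forall>i\<in>K. \<forall>j\<in>I. \<not> independent_of I X (\<lambda>x. f x i) j \<longrightarrow>
         (\<exists>\<B>. \<forall>b. slice (I \<union> K) i b (graph_of I K X f) \<noteq> {} \<longrightarrow>
            (\<exists>X' f'.
               graph_of (I - {j}) (insert j (K - {i})) X' f' =
                 slice (I \<union> K) i b (graph_of I K X f) \<and>
               monotone_map S (I - {j}) (insert j (K - {i})) X' f' \<and>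
               basis_sets (I - {j}) (insert j (K - {i})) X' f' = \<B>))"

end

theory Submission
  imports Defs
begin

text \<open>
  The key fact is that if \<open>A\<close>, \<open>B\<close> and \<open>A \<union> B\<close> are open and meet every coordinate cone in a connected
  set, then so does \<open>A \<inter> B\<close>; it is a connectedness argument on the slices of a cone and replaces
  the simple connectedness of semi-monotone sets.

  If a monotone function \<open>f\<close> is strictly monotone in \<open>x\<^sub>j\<close>, the projection of \<open>{f = b}\<close> along \<open>x\<^sub>j\<close> is
  the intersection of the projections of \<open>{f < b}\<close> and \<open>{f > b}\<close>, whose union is the projection of
  the domain, and the same holds after imposing \<open>x\<^sub>j < c\<close> or \<open>x\<^sub>j > c\<close>.  Hence \<open>{f = b}\<close> is the graph of
  a function \<open>x\<^sub>j = g\<close> with semi-monotone domain and semi-monotone sub- and superlevel sets.  Locally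
  \<open>g\<close> inherits strict monotonicity or independence in the other variables from \<open>f\<close>, and on the
  line segments in its domain this becomes global, so \<open>g\<close> is a monotone function and induction
  applies.

  Conversely, if the level sets are graphs of monotone functions, they meet every coordinate cone
  \<open>C\<close> in a connected set.  As \<open>X \<inter> C\<close> is connected as well, \<open>{f \<le> b} \<inter> C\<close> is connected,
  and \<open>{f < b} \<inter> C\<close> is an increasing union of such sets.
\<close>

section \<open>Boxes in the span\<close>

text \<open>Two connected open sets with connected union can meet in a disconnected set, as two
  overlapping half annuli do. The cone condition excludes this because cones may fix coordinates by
  equations: the hypotheses on the two sets and their union pass to slices, down to single points.

  In the converse direction the coordinate has to be chosen to suit the cone \<open>C\<close>. If
  \<open>f\<close> depends on some \<open>x_j\<close> that varies in \<open>C\<close>, then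
  \<open>C\<close> restricts \<open>x_j\<close> by at most one strict inequality, and the level set
  inside \<open>C\<close> is the graph of \<open>g\<close> over a set \<open>{g < c}\<close>,
  \<open>{g > c}\<close> or the whole domain, cut by a cone in the other coordinates. If
  \<open>f\<close> is independent of every coordinate that varies in \<open>C\<close>, it is
  constant on the intersection of \<open>X\<close> and \<open>C\<close>. Strict monotonicity in
  \<open>x_j\<close> is recovered from injectivity: a graph \<open>x_j = g\<close> meets each line
  parallel to the \<open>x_j\<close>-axis at most once, and connectedness of \<open>X\<close> makes
  the direction the same on all lines.

  The systems of basis sets do not vary with \<open>b\<close> because they are determined by the set
  of coordinates on which \<open>f\<close> depends.\<close>

text \<open>Open boxes of the maximum norm; for finite \<open>I\<close> they form a base of
  \<open>powertop_real I\<close>, and openness, connectedness and continuity are all translated into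
  them.\<close>

definition near :: "nat set \<Rightarrow> real \<Rightarrow> (nat \<Rightarrow> real) \<Rightarrow> (nat \<Rightarrow> real) \<Rightarrow> bool" where
  "near I e z w \<longleftrightarrow> (\<forall>i\<in>I. \<bar>w i - z i\<bar> < e)"

lemma near_mono: "near I d z w \<Longrightarrow> d \<le> e \<Longrightarrow> near I e z w"
  unfolding near_def by fastforce

lemma near_refl: "e > 0 \<Longrightarrow> near I e z z"
  by (simp add: near_def)

lemma near_upd: "e > 0 \<Longrightarrow> \<bar>s - z j\<bar> < e \<Longrightarrow> near I e z (z(j := s))"
  by (simp add: near_def)

lemma span_upd: "z \<in> span_of I \<Longrightarrow> j \<in> I \<Longrightarrow> z(j := s) \<in> span_of I"
  by (auto simp: PiE_iff extensional_def)

lemma span_eqI: "z \<in> span_of I \<Longrightarrow> w \<in> span_of I \<Longrightarrow> (\<And>i. i \<in> I \<Longrightarrow> z i = w i) \<Longrightarrow> z = w"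
  by (rule PiE_ext)

lemma restrict_upd: "x \<in> span_of I \<Longrightarrow> j \<in> I \<Longrightarrow> (restrict x (I - {j}))(j := s) = x(j := s)"
  by (auto simp: PiE_iff extensional_def fun_eq_iff)

lemma upd_span: "x \<in> span_of (I - {j}) \<Longrightarrow> j \<in> I \<Longrightarrow> x(j := s) \<in> span_of I"
  by (auto simp: PiE_iff extensional_def)

lemma restrict_upd_span: "x \<in> span_of (I - {j}) \<Longrightarrow> restrict (x(j := s)) (I - {j}) = x"
  by (auto simp: PiE_iff extensional_def fun_eq_iff)

lemma openin_span_iff:
  assumes "finite I"
  shows "openin (powertop_real I) X \<longleftrightarrow>
    X \<subseteq> span_of I \<and> (\<forall>z\<in>X. \<exists>e>0. \<forall>w\<in>span_of I. near I e z w \<longrightarrow> w \<in> X)"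
proof (intro iffI conjI ballI)
  assume X: "openin (powertop_real I) X"
  then show "X \<subseteq> span_of I"
    using openin_subset by fastforce
  fix z assume z: "z \<in> X"
  then obtain U where U: "\<forall>i\<in>I. open (U i)" "z \<in> PiE I U" "PiE I U \<subseteq> X"
    using X[unfolded openin_product_topology_alt, rule_format, OF z] by auto
  have "\<exists>d>0. \<forall>t. \<bar>t - z i\<bar> < d \<longrightarrow> t \<in> U i" if "i \<in> I" for i
    using U that by (metis PiE_mem dist_real_def open_dist)
  then obtain d where d: "\<And>i. i \<in> I \<Longrightarrow> d i > 0 \<and> (\<forall>t. \<bar>t - z i\<bar> < d i \<longrightarrow> t \<in> U i)"
    by metis
  \<comment> \<open>The inserted 1 keeps the minimum meaningful when \<open>I\<close> is
    empty.\<close>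
  define e where "e = Min (insert 1 (d ` I))"
  have e: "e > 0" "\<And>i. i \<in> I \<Longrightarrow> e \<le> d i"
    using assms d by (auto simp: e_def)
  have "w \<in> X" if "w \<in> span_of I" "near I e z w" for w
  proof -
    have "w i \<in> U i" if "i \<in> I" for i
      using d[OF that] e(2)[OF that] \<open>near I e z w\<close> that unfolding near_def by force
    then show ?thesis
      using that U(3) by (meson PiE_iff subsetD)
  qed
  then show "\<exists>e>0. \<forall>w\<in>span_of I. near I e z w \<longrightarrow> w \<in> X"
    using e(1) by blast
next
  assume X: "X \<subseteq> span_of I \<and> (\<forall>z\<in>X. \<exists>e>0. \<forall>w\<in>span_of I. near I e z w \<longrightarrow> w \<in> X)"
  show "openin (powertop_real I) X"
    unfolding openin_product_topology_alt
  proof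
    fix z assume z: "z \<in> X"
    then obtain e where e: "e > 0" "\<forall>w\<in>span_of I. near I e z w \<longrightarrow> w \<in> X"
      using X by blast
    have "PiE I (\<lambda>i. {z i - e<..<z i + e}) \<subseteq> X"
    proof
      fix w assume w: "w \<in> PiE I (\<lambda>i. {z i - e<..<z i + e})"
      have "near I e z w"
        unfolding near_def
      proof
        fix i assume "i \<in> I"
        then have "w i \<in> {z i - e<..<z i + e}"
          using w by (rule PiE_mem[rotated])
        then show "\<bar>w i - z i\<bar> < e" by auto
      qed
      then show "w \<in> X" using w e(2) by (auto simp: PiE_iff)
    qed
    moreover have "z \<in> PiE I (\<lambda>i. {z i - e<..<z i + e})"
      using z X e(1) by (auto simp: PiE_iff)
    ultimately show "\<exists>U. finite {i \<in> I. U i \<noteq> topspace euclideanreal} \<and>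
        (\<forall>i\<in>I. openin euclideanreal (U i)) \<and> z \<in> PiE I U \<and> PiE I U \<subseteq> X"
      using assms by (intro exI[of _ "\<lambda>i. {z i - e<..<z i + e}"]) auto
  qed
qed

section \<open>Connectedness through locally constant predicates\<close>

text \<open>Such a \<open>P\<close> cuts out a relatively clopen subset of \<open>A\<close>. As a
  predicate it is carried along projections and graph maps by composition, without constructing open
  sets of the ambient span.\<close>

definition locally_constant :: "nat set \<Rightarrow> (nat \<Rightarrow> real) set \<Rightarrow> ((nat \<Rightarrow> real) \<Rightarrow> bool) \<Rightarrow> bool" where
  "locally_constant I A P \<longleftrightarrow> (\<forall>z\<in>A. \<exists>e>0. \<forall>w\<in>A. near I e z w \<longrightarrow> P w = P z)"

lemma locally_constant_subset:
  "locally_constant I A P \<Longrightarrow> B \<subseteq> A \<Longrightarrow> locally_constant I B P"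
  unfolding locally_constant_def by (meson subsetD)

text \<open>\<open>U\<close> and \<open>V\<close> are the unions of the boxes around the points of
  \<open>A\<close> where \<open>P\<close> holds and where it fails. Boxes of different kinds may
  overlap, but only outside \<open>A\<close>.\<close>

lemma locally_constant_imp_openin:
  assumes "finite I" "A \<subseteq> span_of I" "locally_constant I A P"
  obtains U V where "openin (powertop_real I) U" "openin (powertop_real I) V"
    "A \<subseteq> U \<union> V" "\<And>z. z \<in> A \<Longrightarrow> z \<in> U \<longleftrightarrow> P z" "\<And>z. z \<in> A \<Longrightarrow> z \<in> V \<longleftrightarrow> \<not> P z"
proof -
  obtain e where e: "\<And>z. z \<in> A \<Longrightarrow> e z > 0 \<and> (\<forall>w\<in>A. near I (e z) z w \<longrightarrow> P w = P z)"
    using assms(3) unfolding locally_constant_def by metis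
  define N where "N z = {w \<in> span_of I. near I (e z) z w}" for z
  have N: "openin (powertop_real I) (N z)" if "z \<in> A" for z
    unfolding openin_span_iff[OF assms(1)]
  proof (intro conjI ballI)
    show "N z \<subseteq> span_of I" by (auto simp: N_def)
    fix w assume w: "w \<in> N z"
    define d where "d = Min (insert 1 ((\<lambda>i. e z - \<bar>w i - z i\<bar>) ` I))"
    have d: "d > 0" "\<And>i. i \<in> I \<Longrightarrow> d \<le> e z - \<bar>w i - z i\<bar>"
      using assms(1) w by (auto simp: d_def N_def near_def)
    have "near I (e z) z v" if "near I d w v" for v
      unfolding near_def
    proof
      fix i assume i: "i \<in> I"
      then have "\<bar>v i - w i\<bar> < d" using that by (auto simp: near_def)
      then show "\<bar>v i - z i\<bar> < e z" using d(2)[OF i] by linarith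
    qed
    then show "\<exists>d>0. \<forall>v\<in>span_of I. near I d w v \<longrightarrow> v \<in> N z"
      using d(1) by (auto simp: N_def)
  qed
  have NP: "P w = P z" if "z \<in> A" "w \<in> A" "w \<in> N z" for z w
    using e that by (auto simp: N_def)
  have Nz: "z \<in> N z" if "z \<in> A" for z
    using e that assms(2) by (auto simp: N_def near_refl)
  show thesis
  proof
    show "openin (powertop_real I) (\<Union>(N ` {z\<in>A. P z}))" "openin (powertop_real I) (\<Union>(N ` {z\<in>A. \<not> P z}))"
      using N by blast+
    show "A \<subseteq> \<Union>(N ` {z\<in>A. P z}) \<union> \<Union>(N ` {z\<in>A. \<not> P z})"
      using Nz by blast
    show "z \<in> \<Union>(N ` {z\<in>A. P z}) \<longleftrightarrow> P z" "z \<in> \<Union>(N ` {z\<in>A. \<not> P z}) \<longleftrightarrow> \<not> P z" if "z \<in> A" for z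
      using Nz NP that by blast+
  qed
qed

lemma connectedin_span_iff:
  assumes "finite I"
  shows "connectedin (powertop_real I) A \<longleftrightarrow>
    A \<subseteq> span_of I \<and> (\<forall>P. locally_constant I A P \<longrightarrow> (\<forall>z\<in>A. \<forall>w\<in>A. P z \<longrightarrow> P w))"
proof (intro iffI conjI allI impI ballI)
  assume A: "connectedin (powertop_real I) A"
  then show sub: "A \<subseteq> span_of I"
    using connectedin_subset_topspace by fastforce
  fix P z w assume P: "locally_constant I A P" and zw: "z \<in> A" "w \<in> A" "P z"
  obtain U V where UV: "openin (powertop_real I) U" "openin (powertop_real I) V"
    "A \<subseteq> U \<union> V" "\<And>z. z \<in> A \<Longrightarrow> z \<in> U \<longleftrightarrow> P z" "\<And>z. z \<in> A \<Longrightarrow> z \<in> V \<longleftrightarrow> \<not> P z"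
    using locally_constant_imp_openin[OF assms sub P] by metis
  show "P w"
  proof (rule ccontr)
    assume "\<not> P w"
    then have "U \<inter> V \<inter> A = {}" "U \<inter> A \<noteq> {}" "V \<inter> A \<noteq> {}"
      using zw UV by blast+
    then show False
      using connectedinD[OF A UV(1-3)] by blast
  qed
next
  assume A: "A \<subseteq> span_of I \<and> (\<forall>P. locally_constant I A P \<longrightarrow> (\<forall>z\<in>A. \<forall>w\<in>A. P z \<longrightarrow> P w))"
  have False if E: "openin (powertop_real I) U" "openin (powertop_real I) V"
    "A \<subseteq> U \<union> V" "U \<inter> V \<inter> A = {}" "U \<inter> A \<noteq> {}" "V \<inter> A \<noteq> {}" for U V
  proof -
    have "locally_constant I A (\<lambda>z. z \<in> U)"
      unfolding locally_constant_def
    proof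
      fix z assume z: "z \<in> A"
      have *: "\<exists>e>0. \<forall>w\<in>A. near I e z w \<longrightarrow> w \<in> W" if "z \<in> W" "openin (powertop_real I) W" for W
        using that openin_span_iff[OF assms] A by (meson subsetD)
      show "\<exists>e>0. \<forall>w\<in>A. near I e z w \<longrightarrow> (w \<in> U) = (z \<in> U)"
      proof (cases "z \<in> U")
        case True
        then show ?thesis using *[OF True E(1)] by simp
      next
        case False
        then have "z \<in> V" using E(3) z by blast
        moreover have "w \<notin> U" if "w \<in> A" "w \<in> V" for w using E(4) that by blast
        ultimately show ?thesis using *[OF _ E(2)] False by metis
      qed
    qed
    moreover obtain z w where "z \<in> A" "z \<in> U" "w \<in> A" "w \<in> V" using E(5,6) by blast
    ultimately have "w \<in> U" using A by blast
    then show False using E(4) \<open>w \<in> A\<close> \<open>w \<in> V\<close> by blast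
  qed
  then have "\<nexists>U V. openin (powertop_real I) U \<and> openin (powertop_real I) V \<and>
      A \<subseteq> U \<union> V \<and> U \<inter> V \<inter> A = {} \<and> U \<inter> A \<noteq> {} \<and> V \<inter> A \<noteq> {}"
    by blast
  then show "connectedin (powertop_real I) A"
    unfolding connectedin using A by simp
qed

lemma connectedin_spanD:
  assumes "finite I" "connectedin (powertop_real I) A" "locally_constant I A P" "z \<in> A" "w \<in> A"
  shows "P z = P w"
  using assms(2)[unfolded connectedin_span_iff[OF assms(1)]] assms(3-5) by blast

lemma connectedin_spanI:
  assumes "finite I" "A \<subseteq> span_of I"
    "\<And>P z w. locally_constant I A P \<Longrightarrow> z \<in> A \<Longrightarrow> w \<in> A \<Longrightarrow> P z \<Longrightarrow> P w"
  shows "connectedin (powertop_real I) A"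
  unfolding connectedin_span_iff[OF assms(1)] using assms(2,3) by blast

text \<open>Continuity in terms of boxes, to match the box descriptions of openness and connectedness.\<close>
definition box_continuous :: "nat set \<Rightarrow> (nat \<Rightarrow> real) set \<Rightarrow> ((nat \<Rightarrow> real) \<Rightarrow> real) \<Rightarrow> bool" where
  "box_continuous I X f \<longleftrightarrow> (\<forall>z\<in>X. \<forall>e>0. \<exists>d>0. \<forall>w\<in>X. near I d z w \<longrightarrow> \<bar>f w - f z\<bar> < e)"

lemma box_continuous_minus: "box_continuous I X (\<lambda>x. - f x) \<longleftrightarrow> box_continuous I X f"
proof -
  have "\<bar>- a - (- b)\<bar> = \<bar>a - b\<bar>" for a b :: real by linarith
  then show ?thesis unfolding box_continuous_def by simp
qed

lemma openin_subtopology_span_iff: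
  assumes "finite I" "openin (powertop_real I) X" "A \<subseteq> X"
  shows "openin (subtopology (powertop_real I) X) A \<longleftrightarrow>
    (\<forall>z\<in>A. \<exists>e>0. \<forall>w\<in>X. near I e z w \<longrightarrow> w \<in> A)"
proof -
  have "openin (subtopology (powertop_real I) X) A \<longleftrightarrow> openin (powertop_real I) A"
    using assms by (simp add: openin_open_subtopology)
  also have "\<dots> \<longleftrightarrow> (\<forall>z\<in>A. \<exists>e>0. \<forall>w\<in>X. near I e z w \<longrightarrow> w \<in> A)"
  proof
    assume "openin (powertop_real I) A"
    then show "\<forall>z\<in>A. \<exists>e>0. \<forall>w\<in>X. near I e z w \<longrightarrow> w \<in> A"
      using assms unfolding openin_span_iff[OF assms(1)] by (meson subsetD)
  next
    assume *: "\<forall>z\<in>A. \<exists>e>0. \<forall>w\<in>X. near I e z w \<longrightarrow> w \<in> A"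
    show "openin (powertop_real I) A"
      unfolding openin_span_iff[OF assms(1)]
    proof (intro conjI ballI)
      have X: "X \<subseteq> span_of I" "\<forall>z\<in>X. \<exists>e>0. \<forall>w\<in>span_of I. near I e z w \<longrightarrow> w \<in> X"
        using assms(2) unfolding openin_span_iff[OF assms(1)] by blast+
      then show "A \<subseteq> span_of I" using assms(3) by blast
      fix z assume "z \<in> A"
      obtain e where e: "e > 0" "\<forall>w\<in>X. near I e z w \<longrightarrow> w \<in> A" using * \<open>z \<in> A\<close> by blast
      obtain d where d: "d > 0" "\<forall>w\<in>span_of I. near I d z w \<longrightarrow> w \<in> X"
        using X(2) assms(3) \<open>z \<in> A\<close> by blast
      have "w \<in> A" if "w \<in> span_of I" "near I (min d e) z w" for w
        using that d e by (meson min.cobounded1 min.cobounded2 near_mono)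
      then show "\<exists>e>0. \<forall>w\<in>span_of I. near I e z w \<longrightarrow> w \<in> A"
        using d(1) e(1) by (intro exI[of _ "min d e"]) auto
    qed
  qed
  finally show ?thesis .
qed

text \<open>The bridge from sub- and supermonotonicity, which only speak of upper semicontinuity of
  \<open>f\<close> and of \<open>- f\<close>, to continuity.\<close>

lemma box_continuous_iff_semicontinuous:
  assumes "finite I" "openin (powertop_real I) X"
  shows "box_continuous I X f \<longleftrightarrow>
    upper_semicontinuous_on I X f \<and> upper_semicontinuous_on I X (\<lambda>x. - f x)"
proof -
  have usc: "upper_semicontinuous_on I X g \<longleftrightarrow>
      (\<forall>b. \<forall>z\<in>X. g z < b \<longrightarrow> (\<exists>e>0. \<forall>w\<in>X. near I e z w \<longrightarrow> g w < b))" for g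
  proof -
    have "openin (subtopology (powertop_real I) X) {x \<in> X. g x < b} \<longleftrightarrow>
        (\<forall>z\<in>X. g z < b \<longrightarrow> (\<exists>e>0. \<forall>w\<in>X. near I e z w \<longrightarrow> g w < b))" for b
      using openin_subtopology_span_iff[OF assms, of "{x \<in> X. g x < b}"] by auto
    then show ?thesis unfolding upper_semicontinuous_on_def by simp
  qed
  show ?thesis
  proof (intro iffI)
    assume f: "box_continuous I X f"
    have "upper_semicontinuous_on I X g" if g: "box_continuous I X g" for g
      unfolding usc
    proof (intro allI ballI impI)
      fix b z assume z: "z \<in> X" "g z < b"
      then obtain d where "d > 0" "\<forall>w\<in>X. near I d z w \<longrightarrow> \<bar>g w - g z\<bar> < b - g z"
        using g unfolding box_continuous_def by (meson diff_gt_0_iff_gt)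
      then show "\<exists>e>0. \<forall>w\<in>X. near I e z w \<longrightarrow> g w < b" 
        by (intro exI[of _ d]) fastforce
    qed
    then show "upper_semicontinuous_on I X f \<and> upper_semicontinuous_on I X (\<lambda>x. - f x)"
      using f box_continuous_minus by blast
  next
    assume f: "upper_semicontinuous_on I X f \<and> upper_semicontinuous_on I X (\<lambda>x. - f x)"
    show "box_continuous I X f"
      unfolding box_continuous_def
    proof (intro ballI allI impI)
      fix z and e :: real assume z: "z \<in> X" "e > 0"
      obtain d1 where d1: "d1 > 0" "\<forall>w\<in>X. near I d1 z w \<longrightarrow> f w < f z + e"
        using conjunct1[OF f, unfolded usc, rule_format, of z "f z + e"] z by auto
      obtain d2 where d2: "d2 > 0" "\<forall>w\<in>X. near I d2 z w \<longrightarrow> - f w < - f z + e"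
        using conjunct2[OF f, unfolded usc, rule_format, of z "- f z + e"] z by auto
      have "\<bar>f w - f z\<bar> < e" if "w \<in> X" "near I (min d1 d2) z w" for w
      proof -
        have "f w < f z + e" "- f w < - f z + e"
          using d1 d2 that by (meson min.cobounded1 min.cobounded2 near_mono)+
        then show ?thesis by linarith
      qed
      then show "\<exists>d>0. \<forall>w\<in>X. near I d z w \<longrightarrow> \<bar>f w - f z\<bar> < e"
        using d1(1) d2(1) by (intro exI[of _ "min d1 d2"]) auto
    qed
  qed
qed

lemma continuous_map_iff_box_continuous:
  assumes "finite I" "openin (powertop_real I) X"
  shows "continuous_map (subtopology (powertop_real I) X) euclideanreal f \<longleftrightarrow> box_continuous I X f"
proof -
  have X: "topspace (subtopology (powertop_real I) X) = X"
    by (rule topspace_subtopology_subset[OF openin_subset[OF assms(2)]])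
  have "upper_semicontinuous_on I X (\<lambda>x. - f x) \<longleftrightarrow>
      (\<forall>a. openin (subtopology (powertop_real I) X) {x \<in> X. f x > - a})"
    unfolding upper_semicontinuous_on_def by (simp only: minus_less_iff)
  also have "\<dots> \<longleftrightarrow> (\<forall>a. openin (subtopology (powertop_real I) X) {x \<in> X. f x > a})"
    by (metis minus_minus)
  finally show ?thesis
    unfolding box_continuous_iff_semicontinuous[OF assms] continuous_map_upper_lower_semicontinuous_lt X
      upper_semicontinuous_on_def by blast
qed

section \<open>Coordinate cones\<close>

text \<open>What a coordinate cone can demand of one coordinate other than an equation;
  \<open>UNIV\<close> stands for no demand. These sets are open intervals, which allows moving the
  coordinate a little without leaving the cone.\<close>

definition half_line :: "real set \<Rightarrow> bool" where
  "half_line D \<longleftrightarrow> D = UNIV \<or> (\<exists>c. D = {..<c}) \<or> (\<exists>c. D = {c<..})"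

lemma half_line_open: "half_line D \<Longrightarrow> t \<in> D \<Longrightarrow> \<exists>e>0. \<forall>s. \<bar>s - t\<bar> < e \<longrightarrow> s \<in> D"
proof -
  assume D: "half_line D" "t \<in> D"
  then have "open D" unfolding half_line_def by auto
  then show ?thesis using D(2) by (simp add: open_dist dist_real_def)
qed

lemma half_line_interval: "half_line D \<Longrightarrow> a \<in> D \<Longrightarrow> b \<in> D \<Longrightarrow> a \<le> t \<Longrightarrow> t \<le> b \<Longrightarrow> t \<in> D"
  unfolding half_line_def by auto

text \<open>The product of a cone in the other coordinates with a condition on coordinate
  \<open>j\<close>. Every cone in \<open>I\<close> splits in this way at any chosen
  \<open>j\<close>, so that a condition on \<open>j\<close> can be added or isolated.\<close>

definition cylinder :: "nat set \<Rightarrow> nat \<Rightarrow> (nat \<Rightarrow> real) set \<Rightarrow> real set \<Rightarrow> (nat \<Rightarrow> real) set" where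
  "cylinder I j C D = {z \<in> span_of I. restrict z (I - {j}) \<in> C \<and> z j \<in> D}"

lemma coordinate_cone_span: "coordinate_cone I C \<Longrightarrow> C \<subseteq> span_of I"
  unfolding coordinate_cone_def by auto

lemma coordinate_cone_UNIV: "coordinate_cone I (span_of I)"
  unfolding coordinate_cone_def by (rule exI[of _ "{}"]) auto

lemma coordinate_cone_cylinder:
  assumes "coordinate_cone (I - {j}) C" "j \<in> I" "half_line D \<or> D = {t}"
  shows "coordinate_cone I (cylinder I j C D)"
proof -
  obtain J \<sigma> c where J: "J \<subseteq> I - {j}" "\<forall>j\<in>J. \<sigma> j \<in> {(<), (=), (>)}"
    and C: "C = {z \<in> span_of (I - {j}). \<forall>j\<in>J. \<sigma> j (z j) (c j :: real)}"
    using assms(1) unfolding coordinate_cone_def by auto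
  have restr: "restrict z (I - {j}) \<in> C \<longleftrightarrow> (\<forall>j\<in>J. \<sigma> j (z j) (c j))" if "z \<in> span_of I" for z
    using J(1) unfolding C by auto
  have upd: "coordinate_cone I (cylinder I j C {s. r s d})" if r: "r \<in> {(<), (=), (>)}" for r d
    unfolding coordinate_cone_def
  proof (intro exI conjI)
    show "insert j J \<subseteq> I" using J(1) assms(2) by auto
    show "\<forall>k\<in>insert j J. (\<sigma>(j := r)) k \<in> {(<), (=), (>)}" using J r by auto
    have "(\<forall>k\<in>insert j J. (\<sigma>(j := r)) k (z k) ((c(j := d)) k)) \<longleftrightarrow>
        r (z j) d \<and> (\<forall>j\<in>J. \<sigma> j (z j) (c j))" for z
      using J(1) by auto
    then show "cylinder I j C {s. r s d} =
        {z \<in> span_of I. \<forall>k\<in>insert j J. (\<sigma>(j := r)) k (z k) ((c(j := d)) k)}"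
      using restr unfolding cylinder_def by blast
  qed
  have "D = UNIV \<or> (\<exists>d. D = {s. s < d}) \<or> (\<exists>d. D = {s. s > d}) \<or> D = {s. s = t}"
    using assms(3) unfolding half_line_def lessThan_def greaterThan_def singleton_conv by metis
  then consider "D = UNIV" | d where "D = {s. s < d}" | d where "D = {s. s > d}" | "D = {s. s = t}"
    by metis
  then show ?thesis
  proof cases
    case 1
    have "cylinder I j C UNIV = {z \<in> span_of I. \<forall>j\<in>J. \<sigma> j (z j) (c j)}"
      by (simp add: cylinder_def restr cong: conj_cong)
    moreover have "J \<subseteq> I" using J(1) by blast
    ultimately show ?thesis
      unfolding coordinate_cone_def 1 using J(2)
      by (intro exI[of _ J] exI[of _ \<sigma>] exI[of _ c] conjI)
  next
    case (2 d) then show ?thesis using upd[of "(<)" d] by simp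
  next
    case (3 d) then show ?thesis using upd[of "(>)" d] by simp
  next
    case 4
    have "coordinate_cone I (cylinder I j C {s. s = t})" by (rule upd) simp
    then show ?thesis unfolding 4 .
  qed
qed

lemma coordinate_coneE:
  assumes "coordinate_cone I C" "j \<in> I"
  obtains C' D t where "coordinate_cone (I - {j}) C'" "half_line D \<or> D = {t}" "C = cylinder I j C' D"
proof -
  obtain J \<sigma> c where J: "J \<subseteq> I" "\<forall>j\<in>J. \<sigma> j \<in> {(<), (=), (>)}"
    and C: "C = {z \<in> span_of I. \<forall>j\<in>J. \<sigma> j (z j) (c j :: real)}"
    using assms(1) unfolding coordinate_cone_def by auto
  define C' where "C' = {z \<in> span_of (I - {j}). \<forall>j\<in>J - {j}. \<sigma> j (z j) (c j)}"
  define D where "D = {s. j \<in> J \<longrightarrow> \<sigma> j s (c j)}"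
  show thesis
  proof
    show "coordinate_cone (I - {j}) C'"
      unfolding coordinate_cone_def C'_def using J
      by (intro exI[of _ "J - {j}"] exI[of _ \<sigma>] exI[of _ c]) auto
    show "half_line D \<or> D = {c j}"
    proof (cases "j \<in> J")
      case True
      then consider "\<sigma> j = (<)" | "\<sigma> j = (=)" | "\<sigma> j = (>)" using J by auto
      then show ?thesis
        by cases (auto simp: D_def half_line_def lessThan_def greaterThan_def True)
    next
      case False
      then show ?thesis by (simp add: D_def half_line_def)
    qed
    show "C = cylinder I j C' D"
      using J(1) unfolding C cylinder_def C'_def D_def by auto
  qed
qed

section \<open>Sets meeting every coordinate cone in a connected set\<close>

text \<open>The topological part of semi-monotonicity. Boundedness and definability are inherited
  separately and much more easily.\<close>

definition cone_connected :: "nat set \<Rightarrow> (nat \<Rightarrow> real) set \<Rightarrow> bool" where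
  "cone_connected I X \<longleftrightarrow> openin (powertop_real I) X \<and>
     (\<forall>C. coordinate_cone I C \<longrightarrow> connectedin (powertop_real I) (X \<inter> C))"

lemma semi_monotone_iff:
  "semi_monotone S I X \<longleftrightarrow> cone_connected I X \<and> bounded_in_span I X \<and> definable S I X"
  unfolding semi_monotone_def cone_connected_def by blast

lemma cone_connected_openin: "cone_connected I X \<Longrightarrow> openin (powertop_real I) X"
  by (simp add: cone_connected_def)

lemma cone_connectedD:
  "cone_connected I X \<Longrightarrow> coordinate_cone I C \<Longrightarrow> connectedin (powertop_real I) (X \<inter> C)"
  by (simp add: cone_connected_def)

lemma cone_connected_span: "finite I \<Longrightarrow> cone_connected I X \<Longrightarrow> X \<subseteq> span_of I"
  by (drule cone_connected_openin) (simp add: openin_span_iff)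

lemma cone_connected_box:
  assumes "finite I" "cone_connected I X" "z \<in> X"
  obtains e where "e > 0" "\<And>w. w \<in> span_of I \<Longrightarrow> near I e z w \<Longrightarrow> w \<in> X"
proof -
  have "\<exists>e>0. \<forall>w\<in>span_of I. near I e z w \<longrightarrow> w \<in> X"
    using cone_connected_openin[OF assms(2)] assms(3) by (simp add: openin_span_iff[OF assms(1)])
  then show thesis using that by blast
qed

lemma cone_connected_shift:
  assumes "finite I" "cone_connected I X" "z \<in> X" "j \<in> I"
  obtains e where "e > 0" "\<And>s. \<bar>s - z j\<bar> < e \<Longrightarrow> z(j := s) \<in> X"
proof -
  obtain e where e: "e > 0" "\<And>w. w \<in> span_of I \<Longrightarrow> near I e z w \<Longrightarrow> w \<in> X"
    using cone_connected_box[OF assms(1-3)] by metis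
  have z: "z \<in> span_of I"
    using cone_connected_span[OF assms(1,2)] assms(3) by blast
  show thesis
    by (rule that[OF e(1)]) (intro e(2) span_upd near_upd z assms(4) e(1))
qed

text \<open>If the value \<open>t\<close> were missed, \<open>z j < t\<close> would be locally
  constant on \<open>A\<close>: it cannot change within distance \<open>\<bar>z j - t\<bar>\<close>
  of \<open>z\<close>.\<close>

lemma connectedin_coordinate_interval:
  fixes I :: "nat set"
  assumes "finite I" "connectedin (powertop_real I) A" "j \<in> I" "x \<in> A" "y \<in> A" "x j \<le> t" "t \<le> y j"
  shows "\<exists>z\<in>A. z j = t"
proof (rule ccontr)
  assume *: "\<not> (\<exists>z\<in>A. z j = t)"
  have "locally_constant I A (\<lambda>z. z j < t)"
    unfolding locally_constant_def
  proof
    fix z assume "z \<in> A"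
    then have "\<bar>z j - t\<bar> > 0" using * by auto
    moreover have "(w j < t) = (z j < t)" if "near I \<bar>z j - t\<bar> z w" for w
    proof -
      have "\<bar>w j - z j\<bar> < \<bar>z j - t\<bar>" using that assms(3) by (auto simp: near_def)
      then show ?thesis by linarith
    qed
    ultimately show "\<exists>e>0. \<forall>w\<in>A. near I e z w \<longrightarrow> (w j < t) = (z j < t)" by blast
  qed
  from connectedin_spanD[OF assms(1,2) this assms(4,5)] have "x j < t \<longleftrightarrow> y j < t" .
  moreover have "x j \<noteq> t" using * assms(4) by blast
  ultimately show False using assms(6,7) by linarith
qed

lemma coordinate_cone_line:
  assumes "x \<in> span_of I" "j \<in> I"
  shows "coordinate_cone I {z \<in> span_of I. \<forall>i\<in>I - {j}. z i = x i}"
  unfolding coordinate_cone_def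
  by (rule exI[of _ "I - {j}"], rule exI[of _ "\<lambda>_. (=)"], rule exI[of _ x]) auto

text \<open>An axis-parallel line is a coordinate cone, given by equations for all other
  coordinates, so it meets \<open>X\<close> in an interval.\<close>

lemma cone_connected_line:
  assumes "finite I" "cone_connected I X" "j \<in> I" "x \<in> span_of I"
    and "x(j := a) \<in> X" "x(j := b) \<in> X" "a \<le> t" "t \<le> b"
  shows "x(j := t) \<in> X"
proof -
  let ?L = "{z \<in> span_of I. \<forall>i\<in>I - {j}. z i = x i}"
  have "connectedin (powertop_real I) (X \<inter> ?L)"
    by (rule cone_connectedD[OF assms(2) coordinate_cone_line[OF assms(4,3)]])
  moreover have "x(j := a) \<in> X \<inter> ?L" "x(j := b) \<in> X \<inter> ?L"
    using assms(5,6) span_upd[OF assms(4,3)] by auto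
  ultimately have "\<exists>z\<in>X \<inter> ?L. z j = t"
    by (rule connectedin_coordinate_interval[OF assms(1) _ assms(3)]) (simp_all add: assms(7,8))
  then obtain z where z: "z \<in> X" "z \<in> span_of I" "\<forall>i\<in>I - {j}. z i = x i" "z j = t" by auto
  then have "z = x(j := t)"
    using span_upd[OF assms(4,3), of t] by (intro span_eqI[of z I]) auto
  then show ?thesis using z by simp
qed

text \<open>Induction on the coordinates that vary in the cone.  Over a value \<open>t\<close> of such a coordinate
  the fibre of \<open>A \<inter> B\<close> is connected by the induction hypothesis, and the set of values with
  non-empty fibre has no gap: over a gap the fibre of \<open>A \<union> B\<close> would be split by the fibres of \<open>A\<close>
  and \<open>B\<close>.\<close>
lemma connectedin_Int_cone:
  assumes I: "finite I" and A: "cone_connected I A" and B: "cone_connected I B"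
    and AB: "cone_connected I (A \<union> B)" and C: "coordinate_cone I C"
  shows "connectedin (powertop_real I) (A \<inter> B \<inter> C)"
proof -
  have span: "A \<inter> B \<inter> C \<subseteq> span_of I" for C
    using cone_connected_span[OF I A] by blast
  \<comment> \<open>\<open>F\<close> contains every coordinate in which two points of the cone may
    differ. Fixing coordinate \<open>j\<close> by an equation takes it out of \<open>F\<close>; for
    empty \<open>F\<close> the cone has at most one point.\<close>
  have "connectedin (powertop_real I) (A \<inter> B \<inter> C)"
    if "finite F" "F \<subseteq> I" "coordinate_cone I C" "\<forall>z\<in>C. \<forall>w\<in>C. \<forall>i\<in>I - F. z i = w i" for F C
    using that
  proof (induction F arbitrary: C)
    case empty
    then have "z = w" if "z \<in> C" "w \<in> C" for z w
      using that coordinate_cone_span[OF empty(2)] by (intro span_eqI[of z I]) auto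
    then show ?case by (intro connectedin_spanI[OF I span]) blast
  next
    case (insert j F)
    then have j: "j \<in> I" by blast
    obtain C' D t0 where C': "coordinate_cone (I - {j}) C'" and D: "half_line D \<or> D = {t0}"
      and C: "C = cylinder I j C' D"
      using coordinate_coneE[OF insert.prems(2) j] by metis
    have fibre_cone: "coordinate_cone I (C \<inter> {z. z j = t})" if "t \<in> D" for t
    proof -
      have "C \<inter> {z. z j = t} = cylinder I j C' {t}"
        using that unfolding C cylinder_def by auto
      then show ?thesis using coordinate_cone_cylinder[OF C' j disjI2[OF refl]] by simp
    qed
    have fibre: "connectedin (powertop_real I) (A \<inter> B \<inter> (C \<inter> {z. z j = t}))" if "t \<in> D" for t
    proof (rule insert.IH)
      show "F \<subseteq> I" using insert by blast
      show "coordinate_cone I (C \<inter> {z. z j = t})" by (rule fibre_cone[OF that])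
      show "\<forall>z\<in>C \<inter> {z. z j = t}. \<forall>w\<in>C \<inter> {z. z j = t}. \<forall>i\<in>I - F. z i = w i"
      proof (intro ballI)
        fix z w i assume "z \<in> C \<inter> {z. z j = t}" "w \<in> C \<inter> {z. z j = t}" "i \<in> I - F"
        then show "z i = w i"
          using insert.prems(3) by (cases "i = j") auto
      qed
    qed
    show ?case
    proof (cases "D = {t0}")
      \<comment> \<open>Here the cone already fixes coordinate \<open>j\<close>, so it coincides
        with its only fibre.\<close>
      case True
      then have "C \<inter> {z. z j = t0} = C" unfolding C cylinder_def by auto
      then show ?thesis using fibre[of t0] True by auto
    next
      case False
      with D have D: "half_line D" by blast
      define T where "T = {t. \<exists>z \<in> A \<inter> B \<inter> C. z j = t}"
      have TD: "T \<subseteq> D" unfolding T_def C cylinder_def by auto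
      have T: "t \<in> T" if ab: "a \<in> T" "b \<in> T" "a \<le> t" "t \<le> b" for a b t
      proof -
        obtain x y where x: "x \<in> A \<inter> B \<inter> C" "x j = a" and y: "y \<in> A \<inter> B \<inter> C" "y j = b"
          using ab(1,2) unfolding T_def by blast
        have conn: "connectedin (powertop_real I) (A \<inter> C)" "connectedin (powertop_real I) (B \<inter> C)"
          using cone_connectedD[OF A insert.prems(2)] cone_connectedD[OF B insert.prems(2)] .
        obtain u where u: "u \<in> A \<inter> C" "u j = t"
          using connectedin_coordinate_interval[OF I conn(1) j, of x y t] x y ab(3,4) by auto
        obtain v where v: "v \<in> B \<inter> C" "v j = t"
          using connectedin_coordinate_interval[OF I conn(2) j, of x y t] x y ab(3,4) by auto
        have tD: "t \<in> D" using half_line_interval[OF D _ _ ab(3,4)] TD ab(1,2) by blast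
        let ?E = "C \<inter> {z. z j = t}"
        have AE: "connectedin (powertop_real I) ((A \<union> B) \<inter> ?E)"
          by (rule cone_connectedD[OF AB fibre_cone[OF tD]])
        have "A \<inter> B \<inter> ((A \<union> B) \<inter> ?E) \<noteq> {}"
        proof
          assume *: "A \<inter> B \<inter> ((A \<union> B) \<inter> ?E) = {}"
          show False
          proof (rule connectedinD[OF AE])
            show "openin (powertop_real I) A" "openin (powertop_real I) B"
              using cone_connected_openin A B by auto
          qed (use u v * in auto)
        qed
        then show ?thesis unfolding T_def by blast
      qed
      show ?thesis
      proof (rule connectedin_spanI[OF I span])
        fix P z w
        assume P: "locally_constant I (A \<inter> B \<inter> C) P" and zw: "z \<in> A \<inter> B \<inter> C" "w \<in> A \<inter> B \<inter> C" "P z"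
        have fibreP: "P x = P y" if "x \<in> A \<inter> B \<inter> C" "y \<in> A \<inter> B \<inter> C" "x j = y j" for x y
        proof (rule connectedin_spanD[OF I fibre])
          show "x j \<in> D" using that TD unfolding T_def by blast
          show "locally_constant I (A \<inter> B \<inter> (C \<inter> {z. z j = x j})) P"
            by (rule locally_constant_subset[OF P]) blast
        qed (use that in auto)
        \<comment> \<open>\<open>P\<close> is constant on each fibre and therefore descends to a
          predicate on the interval \<open>T\<close> of values of coordinate
          \<open>j\<close>.\<close>
        define Q where "Q t \<longleftrightarrow> (\<exists>x \<in> A \<inter> B \<inter> C. x j = t \<and> P x)" for t
        have Q: "Q (x j) = P x" if "x \<in> A \<inter> B \<inter> C" for x
          using that fibreP unfolding Q_def by blast
        have "Q (z j) = Q (w j)"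
        proof (rule connected_local_const[where A = T and f = Q])
          show "connected T"
            using T unfolding connected_iff_interval by blast
          have "x j \<in> T" if "x \<in> A \<inter> B \<inter> C" for x
            unfolding T_def by (rule CollectI, rule bexI[of _ x, OF refl that])
          then show "z j \<in> T" "w j \<in> T" using zw(1,2) by auto
          show "\<forall>t\<in>T. \<forall>\<^sub>F s in at t within T. Q t = Q s"
          proof
            fix t assume "t \<in> T"
            then obtain x where x: "x \<in> A \<inter> B \<inter> C" "x j = t" unfolding T_def by auto
            then have xAB: "x \<in> A" "x \<in> B" by auto
            obtain e1 where e1: "e1 > 0" "\<And>s. \<bar>s - x j\<bar> < e1 \<Longrightarrow> x(j := s) \<in> A"
              using cone_connected_shift[OF I A xAB(1) j] by metis
            obtain e2 where e2: "e2 > 0" "\<And>s. \<bar>s - x j\<bar> < e2 \<Longrightarrow> x(j := s) \<in> B"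
              using cone_connected_shift[OF I B xAB(2) j] by metis
            obtain e3 where e3: "e3 > 0" "\<And>s. \<bar>s - x j\<bar> < e3 \<Longrightarrow> s \<in> D"
              using half_line_open[OF D, of "x j"] x(2) TD \<open>t \<in> T\<close> by blast
            obtain e4 where e4: "e4 > 0" "\<And>w. w \<in> A \<inter> B \<inter> C \<Longrightarrow> near I e4 x w \<Longrightarrow> P w = P x"
              using P x unfolding locally_constant_def by blast
            \<comment> \<open>Changing only coordinate \<open>j\<close> of \<open>x\<close> by less
              than \<open>e\<close> keeps the point in \<open>A\<close> and in \<open>B\<close>, its
              \<open>j\<close>-value in \<open>D\<close>, and the truth value of \<open>P\<close>.
              Hence \<open>s\<close> and \<open>t\<close> have the same
              \<open>Q\<close>-value.\<close>
            define e where "e = Min {e1, e2, e3, e4}"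
            have e: "e > 0" "e \<le> e1" "e \<le> e2" "e \<le> e3" "e \<le> e4"
              using e1(1) e2(1) e3(1) e4(1) by (auto simp: e_def)
            have xs: "x \<in> span_of I" using span x(1) by blast
            have "Q t = Q s" if s: "\<bar>s - t\<bar> < e" for s
            proof -
              have "x(j := s) \<in> C"
                using x(1) e3(2)[of s] s e x(2) span_upd[OF xs j] unfolding C cylinder_def
                by (auto simp: restrict_def cong: if_cong)
              then have y: "x(j := s) \<in> A \<inter> B \<inter> C"
                using e1(2)[of s] e2(2)[of s] s e x(2) by auto
              have "near I e4 x (x(j := s))"
                using s x(2) e by (intro near_upd) auto
              then have "P (x(j := s)) = P x" using e4(2) y by blast
              then show ?thesis using Q[OF y] Q[OF x(1)] x(2) by simp
            qed
            then show "\<forall>\<^sub>F s in at t within T. Q t = Q s"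
              unfolding eventually_at using e(1) by (auto simp: dist_real_def intro!: exI[of _ e])
          qed
        qed
        then show "P w" using Q zw by blast
      qed
    qed
  qed
  from this[OF I subset_refl C] show ?thesis by simp
qed

lemma cone_connected_Int:
  assumes "finite I" "cone_connected I A" "cone_connected I B" "cone_connected I (A \<union> B)"
  shows "cone_connected I (A \<inter> B)"
  unfolding cone_connected_def
  using connectedin_Int_cone[OF assms] openin_Int[OF assms(2,3)[THEN cone_connected_openin]] by simp

section \<open>Projections along a coordinate\<close>

definition drop_coord :: "nat set \<Rightarrow> nat \<Rightarrow> (nat \<Rightarrow> real) set \<Rightarrow> (nat \<Rightarrow> real) set" where
  "drop_coord I j A = (\<lambda>z. restrict z (I - {j})) ` A"

lemma drop_coord_eq:
  assumes "A \<subseteq> span_of I" "j \<in> I"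
  shows "drop_coord I j A = {x \<in> span_of (I - {j}). \<exists>s. x(j := s) \<in> A}"
proof (intro equalityI subsetI)
  fix x assume "x \<in> drop_coord I j A"
  then obtain z where z: "z \<in> A" "x = restrict z (I - {j})" unfolding drop_coord_def by blast
  then have "x(j := z j) = z" using restrict_upd[of z I j "z j"] assms by auto
  then have "x(j := z j) \<in> A" using z(1) by simp
  moreover have "x \<in> span_of (I - {j})" unfolding z(2) by (simp add: restrict_PiE_iff)
  ultimately show "x \<in> {x \<in> span_of (I - {j}). \<exists>s. x(j := s) \<in> A}" by blast
next
  fix x assume "x \<in> {x \<in> span_of (I - {j}). \<exists>s. x(j := s) \<in> A}"
  then show "x \<in> drop_coord I j A"
  proof (elim CollectE conjE exE)
    fix s assume x: "x \<in> span_of (I - {j})" "x(j := s) \<in> A"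
    show "x \<in> drop_coord I j A"
      unfolding drop_coord_def using x restrict_upd_span[OF x(1), of s]
      by (intro image_eqI[of _ _ "x(j := s)"]) auto
  qed
qed

lemma connectedin_drop_coord:
  assumes "finite I" "connectedin (powertop_real I) A"
  shows "connectedin (powertop_real (I - {j})) (drop_coord I j A)"
proof (rule connectedin_spanI)
  show "finite (I - {j})" using assms by blast
  show "drop_coord I j A \<subseteq> span_of (I - {j})" unfolding drop_coord_def by (intro image_subsetI) (simp add: restrict_PiE_iff)
  fix P z w
  assume P: "locally_constant (I - {j}) (drop_coord I j A) P"
    and zw: "z \<in> drop_coord I j A" "w \<in> drop_coord I j A" "P z"
  obtain z0 w0 where zw0: "z0 \<in> A" "z = restrict z0 (I - {j})" "w0 \<in> A" "w = restrict w0 (I - {j})"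
    using zw unfolding drop_coord_def by blast
  have "locally_constant I A (\<lambda>z. P (restrict z (I - {j})))"
    unfolding locally_constant_def
  proof
    fix x assume x: "x \<in> A"
    then obtain e where "e > 0" "\<forall>w\<in>drop_coord I j A. near (I - {j}) e (restrict x (I - {j})) w \<longrightarrow>
        P w = P (restrict x (I - {j}))"
      using P unfolding locally_constant_def drop_coord_def by blast
    moreover have "near (I - {j}) e (restrict x (I - {j})) (restrict w (I - {j}))" if "near I e x w" for w
      using that by (auto simp: near_def)
    ultimately show "\<exists>e>0. \<forall>w\<in>A. near I e x w \<longrightarrow> P (restrict w (I - {j})) = P (restrict x (I - {j}))"
      unfolding drop_coord_def by blast
  qed
  then show "P w"
    using connectedin_spanD[OF assms(1,2) _ zw0(1,3)] zw(3) zw0 by blast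
qed

text \<open>The points whose projection lies in a cone \<open>C\<close> and whose
  \<open>j\<close>-value lies in \<open>D\<close> again form a cone,
  \<open>cylinder I j C D\<close>. So the set to be shown connected is the projection of a connected
  one.\<close>

lemma cone_connected_drop_coord:
  assumes I: "finite I" "j \<in> I" and X: "cone_connected I X" and D: "half_line D"
  shows "cone_connected (I - {j}) (drop_coord I j {z \<in> X. z j \<in> D})"
  unfolding cone_connected_def
proof (intro conjI allI impI)
  have sub: "{z \<in> X. z j \<in> D} \<subseteq> span_of I" using cone_connected_span[OF I(1) X] by blast
  have eq: "drop_coord I j {z \<in> X. z j \<in> D} = {x \<in> span_of (I - {j}). \<exists>s\<in>D. x(j := s) \<in> X}"
    unfolding drop_coord_eq[OF sub I(2)] by auto
  have "finite (I - {j})" using I by blast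
  then show "openin (powertop_real (I - {j})) (drop_coord I j {z \<in> X. z j \<in> D})"
    unfolding openin_span_iff[OF \<open>finite (I - {j})\<close>] eq
  proof (intro conjI ballI)
    fix x assume "x \<in> {x \<in> span_of (I - {j}). \<exists>s\<in>D. x(j := s) \<in> X}"
    then obtain s where s: "x \<in> span_of (I - {j})" "s \<in> D" "x(j := s) \<in> X" by blast
    obtain e where e: "e > 0" "\<And>w. w \<in> span_of I \<Longrightarrow> near I e (x(j := s)) w \<Longrightarrow> w \<in> X"
      using cone_connected_box[OF I(1) X s(3)] by blast
    \<comment> \<open>The same height \<open>s\<close> serves for all nearby
      \<open>w\<close>.\<close>
    have "w(j := s) \<in> X" if "w \<in> span_of (I - {j})" "near (I - {j}) e x w" for w
      using that I(2) e upd_span by (auto simp: near_def)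
    then show "\<exists>e>0. \<forall>w\<in>span_of (I - {j}). near (I - {j}) e x w \<longrightarrow>
        w \<in> {x \<in> span_of (I - {j}). \<exists>s\<in>D. x(j := s) \<in> X}"
      using e(1) s(2) by blast
  qed auto
  fix C assume C: "coordinate_cone (I - {j}) C"
  have "drop_coord I j {z \<in> X. z j \<in> D} \<inter> C = drop_coord I j (X \<inter> cylinder I j C D)"
    using cone_connected_span[OF I(1) X] unfolding drop_coord_def cylinder_def by blast
  moreover have "connectedin (powertop_real I) (X \<inter> cylinder I j C D)"
    by (rule cone_connectedD[OF X coordinate_cone_cylinder[OF C I(2) disjI1[OF D]]])
  ultimately show "connectedin (powertop_real (I - {j})) (drop_coord I j {z \<in> X. z j \<in> D} \<inter> C)"
    using connectedin_drop_coord[OF I(1)] by simp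
qed

section \<open>Level sets\<close>

text \<open>A single form for increase, decrease and independence, so that one argument with a
  variable relation \<open>R\<close> treats all three; passing to the converse relation exchanges
  the first two.\<close>

definition rel_in ::
    "(real \<Rightarrow> real \<Rightarrow> bool) \<Rightarrow> nat set \<Rightarrow> (nat \<Rightarrow> real) set \<Rightarrow> ((nat \<Rightarrow> real) \<Rightarrow> real) \<Rightarrow> nat \<Rightarrow> bool"
  where "rel_in R I X f j \<longleftrightarrow>
    (\<forall>x\<in>X. \<forall>y\<in>X. (\<forall>i\<in>I - {j}. x i = y i) \<and> x j < y j \<longrightarrow> R (f x) (f y))"

lemma rel_in_simps:
  "rel_in (<) I X f j = strictly_increasing_in I X f j"
  "rel_in (>) I X f j = strictly_decreasing_in I X f j"
  "rel_in (=) I X f j = independent_of I X f j"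
  unfolding rel_in_def strictly_increasing_in_def strictly_decreasing_in_def independent_of_def
  by (rule refl)+

lemma rel_in_upd:
  "rel_in R I X f j \<Longrightarrow> x(j := a) \<in> X \<Longrightarrow> x(j := b) \<in> X \<Longrightarrow> a < b \<Longrightarrow> R (f (x(j := a))) (f (x(j := b)))"
  unfolding rel_in_def by fastforce

lemma rel_inI:
  assumes "X \<subseteq> span_of I"
    "\<And>x a b. x(j := a) \<in> X \<Longrightarrow> x(j := b) \<in> X \<Longrightarrow> a < b \<Longrightarrow> R (f (x(j := a))) (f (x(j := b)))"
  shows "rel_in R I X f j"
  unfolding rel_in_def
proof (intro ballI impI, elim conjE)
  fix x y assume xy: "x \<in> X" "y \<in> X" "\<forall>i\<in>I - {j}. x i = y i" "x j < y j"
  have "y = x(j := y j)"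
  proof
    fix i show "y i = (x(j := y j)) i"
      using xy PiE_arb[OF subsetD[OF assms(1) xy(1)], of i] PiE_arb[OF subsetD[OF assms(1) xy(2)], of i]
      by (cases "i \<in> I") auto
  qed
  then show "R (f x) (f y)"
    using assms(2)[of x "x j" "y j"] xy by simp
qed

lemma rel_in_flip:
  assumes "R \<in> {(<), (>), (=)}" "rel_in R I X f j"
  shows "rel_in (\<lambda>a b. R b a) I X (\<lambda>x. - f x) j"
  using assms unfolding rel_in_def by auto

definition monotone_in ::
    "nat set \<Rightarrow> (nat \<Rightarrow> real) set \<Rightarrow> ((nat \<Rightarrow> real) \<Rightarrow> real) \<Rightarrow> nat \<Rightarrow> bool" where
  "monotone_in I X f j \<longleftrightarrow> strictly_increasing_in I X f j \<or> strictly_decreasing_in I X f j"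

lemma monotone_in_upd:
  assumes "monotone_in I X f j" "x(j := a) \<in> X" "x(j := b) \<in> X" "f (x(j := a)) = f (x(j := b))"
  shows "a = b"
proof (rule ccontr)
  assume "a \<noteq> b"
  then consider "a < b" | "b < a" by linarith
  then show False
    using assms rel_in_upd[of "(<)" I X f j x] rel_in_upd[of "(>)" I X f j x]
    unfolding monotone_in_def rel_in_simps by cases (metis less_irrefl)+
qed

lemma continuous_on_line:
  assumes "box_continuous I X f" "x \<in> span_of I" "j \<in> I"
  shows "continuous_on {s. x(j := s) \<in> X} (\<lambda>s. f (x(j := s)))"
  unfolding continuous_on_iff
proof (intro ballI allI impI)
  fix s and e :: real assume s: "s \<in> {s. x(j := s) \<in> X}" "0 < e"
  then obtain d where d: "d > 0" "\<And>w. w \<in> X \<Longrightarrow> near I d (x(j := s)) w \<Longrightarrow> \<bar>f w - f (x(j := s))\<bar> < e"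
    using assms(1) unfolding box_continuous_def by blast
  have "near I d (x(j := s)) (x(j := t))" if "\<bar>t - s\<bar> < d" for t
    using that d(1) unfolding near_def by simp
  then show "\<exists>d>0. \<forall>t\<in>{s. x(j := s) \<in> X}. dist t s < d \<longrightarrow> dist (f (x(j := t))) (f (x(j := s))) < e"
    using d unfolding dist_real_def by (intro exI[of _ d]) simp
qed

text \<open>Over a point of the level set, moving \<open>x_j\<close> slightly down and up stays in
  \<open>X\<close> and in \<open>D\<close> and reaches values on both sides of \<open>b\<close>, by
  strict monotonicity. Conversely, if a line carries values on both sides of \<open>b\<close>, the
  intermediate value theorem on the segment between them yields the value \<open>b\<close>.\<close>

lemma drop_coord_level_eq:
  assumes I: "finite I" "j \<in> I" and X: "cone_connected I X" and f: "box_continuous I X f"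
    and mono: "monotone_in I X f j" and D: "half_line D"
  defines "Y \<equiv> \<lambda>P. drop_coord I j {x \<in> {x \<in> X. P (f x)}. x j \<in> D}"
  shows "Y (\<lambda>y. y < b) \<inter> Y (\<lambda>y. y > b) = Y (\<lambda>y. y = b)"
    and "Y (\<lambda>y. y < b) \<union> Y (\<lambda>y. y > b) = Y (\<lambda>_. True)"
proof -
  have span: "{x \<in> {x \<in> X. P (f x)}. x j \<in> D} \<subseteq> span_of I" for P
    using cone_connected_span[OF I(1) X] by blast
  have Y: "x \<in> Y P \<longleftrightarrow> x \<in> span_of (I - {j}) \<and> (\<exists>s\<in>D. x(j := s) \<in> X \<and> P (f (x(j := s))))" for x P
    unfolding Y_def drop_coord_eq[OF span I(2)] by auto
  have sides: "(\<exists>s\<in>D. x(j := s) \<in> X \<and> f (x(j := s)) < b) \<and> (\<exists>s\<in>D. x(j := s) \<in> X \<and> f (x(j := s)) > b)"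
    if x: "s \<in> D" "x(j := s) \<in> X" "f (x(j := s)) = b" for x s
  proof -
    obtain e where e: "e > 0" "\<And>t. \<bar>t - s\<bar> < e \<Longrightarrow> x(j := t) \<in> X"
      using cone_connected_shift[OF I(1) X x(2) I(2)] by (metis fun_upd_same fun_upd_upd)
    obtain d where d: "d > 0" "\<And>t. \<bar>t - s\<bar> < d \<Longrightarrow> t \<in> D"
      using half_line_open[OF D x(1)] by blast
    \<comment> \<open>Half of the smaller radius, so that both points stay within \<open>d\<close>
      and within \<open>e\<close> of \<open>s\<close>.\<close>
    define t u where "t = s - min d e / 2" and "u = s + min d e / 2"
    have tu: "t < s" "s < u" "\<bar>t - s\<bar> < e" "\<bar>u - s\<bar> < e" "\<bar>t - s\<bar> < d" "\<bar>u - s\<bar> < d"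
      using e(1) d(1) unfolding t_def u_def by (auto simp: min_def)
    then have mem: "t \<in> D" "u \<in> D" "x(j := t) \<in> X" "x(j := u) \<in> X"
      using d(2) e(2) by blast+
    show ?thesis
      using mono unfolding monotone_in_def
    proof
      assume "strictly_increasing_in I X f j"
      then have "f (x(j := t)) < b" "f (x(j := u)) > b"
        using rel_in_upd[of "(<)" I X f j x] tu mem x unfolding rel_in_simps by metis+
      then show ?thesis using mem by blast
    next
      assume "strictly_decreasing_in I X f j"
      then have "f (x(j := t)) > b" "f (x(j := u)) < b"
        using rel_in_upd[of "(>)" I X f j x] tu mem x unfolding rel_in_simps by metis+
      then show ?thesis using mem by blast
    qed
  qed
  have between: "\<exists>s\<in>D. x(j := s) \<in> X \<and> f (x(j := s)) = b"
    if x: "x \<in> span_of (I - {j})" and u: "u \<in> D" "x(j := u) \<in> X" "f (x(j := u)) < b"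
      and v: "v \<in> D" "x(j := v) \<in> X" "f (x(j := v)) > b" for x u v
  proof -
    define y where "y = x(j := u)"
    have y: "y \<in> span_of I" "\<And>s. y(j := s) = x(j := s)"
      using upd_span[OF x I(2)] by (auto simp: y_def)
    \<comment> \<open>The two points can come in either order, depending on the direction in which
      \<open>f\<close> is monotone.\<close>
    define T where "T = {min u v..max u v}"
    have T: "s \<in> D \<and> x(j := s) \<in> X" if "s \<in> T" for s
    proof (cases "u \<le> v")
      case True
      then show ?thesis
        using that half_line_interval[OF D u(1) v(1), of s] cone_connected_line[OF I(1) X I(2) y(1), of u v s] y(2) u(2) v(2)
        by (auto simp: T_def)
    next
      case False
      then show ?thesis
        using that half_line_interval[OF D v(1) u(1), of s] cone_connected_line[OF I(1) X I(2) y(1), of v u s] y(2) u(2) v(2)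
        by (auto simp: T_def)
    qed
    have "continuous_on T (\<lambda>s. f (x(j := s)))"
      using continuous_on_line[OF f y(1) I(2)] unfolding y(2)
      by (rule continuous_on_subset) (use T in auto)
    then have "connected ((\<lambda>s. f (x(j := s))) ` T)"
      by (rule connected_continuous_image) (simp add: T_def)
    moreover have "f (x(j := u)) \<in> (\<lambda>s. f (x(j := s))) ` T" "f (x(j := v)) \<in> (\<lambda>s. f (x(j := s))) ` T"
      by (rule imageI, simp add: T_def)+
    ultimately have "b \<in> (\<lambda>s. f (x(j := s))) ` T"
      using u(3) v(3) unfolding connected_iff_interval by (meson less_imp_le)
    then show ?thesis using T by auto
  qed
  show "Y (\<lambda>y. y < b) \<inter> Y (\<lambda>y. y > b) = Y (\<lambda>y. y = b)"
  proof (intro equalityI subsetI)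
    fix x assume "x \<in> Y (\<lambda>y. y < b) \<inter> Y (\<lambda>y. y > b)"
    then show "x \<in> Y (\<lambda>y. y = b)" unfolding Int_iff Y using between by blast
  next
    fix x assume "x \<in> Y (\<lambda>y. y = b)"
    then show "x \<in> Y (\<lambda>y. y < b) \<inter> Y (\<lambda>y. y > b)" unfolding Int_iff Y using sides by metis
  qed
  show "Y (\<lambda>y. y < b) \<union> Y (\<lambda>y. y > b) = Y (\<lambda>_. True)"
  proof (intro equalityI subsetI)
    fix x assume "x \<in> Y (\<lambda>y. y < b) \<union> Y (\<lambda>y. y > b)"
    then show "x \<in> Y (\<lambda>_. True)" unfolding Un_iff Y by blast
  next
    fix x assume "x \<in> Y (\<lambda>_. True)"
    then obtain s where s: "x \<in> span_of (I - {j})" "s \<in> D" "x(j := s) \<in> X" unfolding Y by blast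
    \<comment> \<open>A point of value exactly \<open>b\<close> is covered too, since its line
      carries smaller and larger values.\<close>
    show "x \<in> Y (\<lambda>y. y < b) \<union> Y (\<lambda>y. y > b)"
      using linorder_less_linear[of "f (x(j := s))" b] s sides[OF s(2,3)] unfolding Un_iff Y by metis
  qed
qed

lemma cone_connected_drop_level:
  assumes I: "finite I" "j \<in> I" and X: "cone_connected I X" and f: "box_continuous I X f"
    and lo: "cone_connected I {x \<in> X. f x < b}" and hi: "cone_connected I {x \<in> X. f x > b}"
    and mono: "monotone_in I X f j" and D: "half_line D"
  shows "cone_connected (I - {j}) (drop_coord I j {x \<in> {x \<in> X. f x = b}. x j \<in> D})"
proof -
  note eq = drop_coord_level_eq[OF I X f mono D, of b]
  show ?thesis
    unfolding eq(1)[symmetric]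
  proof (rule cone_connected_Int)
    show "finite (I - {j})" using I by blast
    show "cone_connected (I - {j}) (drop_coord I j {x \<in> {x \<in> X. f x < b}. x j \<in> D})"
      by (rule cone_connected_drop_coord[OF I lo D])
    show "cone_connected (I - {j}) (drop_coord I j {x \<in> {x \<in> X. f x > b}. x j \<in> D})"
      by (rule cone_connected_drop_coord[OF I hi D])
    show "cone_connected (I - {j}) (drop_coord I j {x \<in> {x \<in> X. f x < b}. x j \<in> D} \<union>
        drop_coord I j {x \<in> {x \<in> X. f x > b}. x j \<in> D})"
      unfolding eq(2) using cone_connected_drop_coord[OF I X D] by simp
  qed
qed

section \<open>Monotonicity of the function defined by a level set\<close>

text \<open>Bisection: a transitive relation that holds between each point and its neighbours can be
  chained along a compact interval. Comparing with the centre point \<open>t\<close> alone suffices,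
  because \<open>t\<close> separates the two ends of a small interval around it.\<close>

lemma interval_local_to_global:
  fixes a b :: real
  assumes R: "\<And>x y z. R x y \<Longrightarrow> R y z \<Longrightarrow> R x z" and ab: "a < b"
    and loc: "\<And>t. t \<in> {a..b} \<Longrightarrow> \<exists>d>0. \<forall>s\<in>{a..b}. \<bar>s - t\<bar> < d \<longrightarrow>
      (t < s \<longrightarrow> R (h t) (h s)) \<and> (s < t \<longrightarrow> R (h s) (h t))"
  shows "R (h a) (h b)"
proof -
  have "a \<le> b" using ab by simp
  \<comment> \<open>The guards in the induction predicate exclude intervals that stick out of
    \<open>{a..b}\<close>, where \<open>h\<close> is not controlled, and degenerate ones, where an
    irreflexive \<open>R\<close> fails.\<close>
  then have "a \<le> a \<and> b \<le> b \<and> a < b \<longrightarrow> R (h a) (h b)"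
  proof (induction rule: Bolzano[where P = "\<lambda>u v. a \<le> u \<and> v \<le> b \<and> u < v \<longrightarrow> R (h u) (h v)"])
    case (trans u v w)
    then show ?case using R by (metis dual_order.trans order_less_le)
  next
    case (local x)
    then obtain d where d: "d > 0" "\<And>s. s \<in> {a..b} \<Longrightarrow> \<bar>s - x\<bar> < d \<Longrightarrow>
        (x < s \<longrightarrow> R (h x) (h s)) \<and> (s < x \<longrightarrow> R (h s) (h x))"
      using loc[of x] by auto
    have "R (h u) (h v)" if "u \<le> x" "x \<le> v" "v - u < d" "a \<le> u" "v \<le> b" "u < v" for u v
    proof -
      have "\<bar>u - x\<bar> < d" "\<bar>v - x\<bar> < d" "u \<in> {a..b}" "v \<in> {a..b}" using that by auto
      then have "x < v \<longrightarrow> R (h x) (h v)" "u < x \<longrightarrow> R (h u) (h x)" using d(2) by auto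
      then show ?thesis using that R by (metis order_less_le)
    qed
    then show ?case using d(1) by blast
  qed
  then show ?thesis using ab by simp
qed

text \<open>The sign rule of implicit differentiation without derivatives. When \<open>x_l\<close>
  moves from \<open>t\<close> to \<open>s\<close> with \<open>x_j\<close> frozen at its old height,
  \<open>f\<close> changes from \<open>b\<close> according to \<open>R\<close>; as \<open>f\<close>
  increases in \<open>x_j\<close>, returning to the level \<open>b\<close> moves the height the
  opposite way, hence the converse relation for \<open>g\<close>. Freezing \<open>x_j\<close> may
  leave \<open>X\<close> for distant \<open>s\<close>, so this is a local statement that is then
  chained along the segment.\<close>

lemma rel_in_level_function_increasing:
  assumes I: "finite I" "j \<in> I" "l \<in> I - {j}" and X: "cone_connected I X"
    and inc: "strictly_increasing_in I X f j"
    and X': "cone_connected (I - {j}) X'"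
    and g: "\<And>x. x \<in> X' \<Longrightarrow> x(j := g x) \<in> X \<and> f (x(j := g x)) = b"
    and R: "R \<in> {(<), (>), (=)}" "rel_in R I X f l"
  shows "rel_in (\<lambda>x y. R y x) (I - {j}) X' g l"
proof (rule rel_inI)
  have fin: "finite (I - {j})" using I by blast
  show span': "X' \<subseteq> span_of (I - {j})" by (rule cone_connected_span[OF fin X'])
  fix x and p q :: real assume pq: "x(l := p) \<in> X'" "x(l := q) \<in> X'" "p < q"
  define y where "y = x(l := p)"
  have y: "y \<in> span_of (I - {j})" "\<And>s. y(l := s) = x(l := s)"
    using pq span' by (auto simp: y_def)
  have mem: "x(l := s) \<in> X'" if "s \<in> {p..q}" for s
    using cone_connected_line[OF fin X' I(3) y(1), of p q s] that pq unfolding y(2) by auto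
  \<comment> \<open>Strict increase in \<open>x_j\<close> lets each of the three relations be read
    back from values of \<open>f\<close> to heights.\<close>
  have order: "R u v" if "z(j := u) \<in> X" "z(j := v) \<in> X" "R (f (z(j := u))) (f (z(j := v)))" for z u v
  proof -
    have "u < v \<Longrightarrow> f (z(j := u)) < f (z(j := v))" "v < u \<Longrightarrow> f (z(j := v)) < f (z(j := u))"
      using rel_in_upd[of "(<)" I X f j z] inc that unfolding rel_in_simps by blast+
    then show ?thesis using R(1) that(3) by (cases u v rule: linorder_cases) auto
  qed
  show "R (g (x(l := q))) (g (x(l := p)))"
  proof (rule interval_local_to_global[where R = "\<lambda>u v. R v u" and h = "\<lambda>s. g (x(l := s))", OF _ pq(3)])
    show "\<And>x y z. R y x \<Longrightarrow> R z y \<Longrightarrow> R z x" using R(1) by auto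
    fix t assume t: "t \<in> {p..q}"
    let ?z = "(x(l := t))(j := g (x(l := t)))"
    have z: "?z \<in> X" "f ?z = b" using g mem[OF t] by auto
    have lj: "l \<noteq> j" "l \<in> I" using I by auto
    \<comment> \<open>The radius within which \<open>x_l\<close> can move while \<open>x_j\<close>
      stays frozen.\<close>
    obtain e where e: "e > 0" "\<And>s. \<bar>s - t\<bar> < e \<Longrightarrow> ?z(l := s) \<in> X"
      using cone_connected_shift[OF I(1) X z(1) lj(2)] lj(1) by auto
    have "(t < s \<longrightarrow> R (g (x(l := s))) (g (x(l := t)))) \<and> (s < t \<longrightarrow> R (g (x(l := t))) (g (x(l := s))))"
      if s: "s \<in> {p..q}" "\<bar>s - t\<bar> < e" for s
    proof -
      let ?w = "x(l := s)" and ?u = "g (x(l := t))"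
      have w: "?w(j := g ?w) \<in> X" "f (?w(j := g ?w)) = b" using g mem[OF s(1)] by auto
      have eq: "?z(l := s) = ?w(j := ?u)" "?z = ?z(l := t)" using lj(1) by (auto simp: fun_eq_iff)
      have wu: "?w(j := ?u) \<in> X" using e(2)[OF s(2)] eq by simp
      have "R b (f (?w(j := ?u)))" if "t < s"
        using rel_in_upd[OF R(2), of ?z t s] that z wu eq by simp
      moreover have "R (f (?w(j := ?u))) b" if "s < t"
        using rel_in_upd[OF R(2), of ?z s t] that z wu eq by simp
      ultimately show ?thesis using order[OF w(1) wu] order[OF wu w(1)] w(2) by auto
    qed
    then show "\<exists>d>0. \<forall>s\<in>{p..q}. \<bar>s - t\<bar> < d \<longrightarrow>
      (t < s \<longrightarrow> R (g (x(l := s))) (g (x(l := t)))) \<and> (s < t \<longrightarrow> R (g (x(l := t))) (g (x(l := s))))"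
      using e(1) by blast
  qed
qed

text \<open>The decreasing case is the increasing one for \<open>- f\<close> at level
  \<open>- b\<close>, which has the same level set; negation replaces \<open>R\<close> by its
  converse, and the conclusion reverses it once more.\<close>

lemma rel_in_level_function:
  assumes I: "finite I" "j \<in> I" "l \<in> I - {j}" and X: "cone_connected I X"
    and mono: "monotone_in I X f j"
    and X': "cone_connected (I - {j}) X'"
    and g: "\<And>x. x \<in> X' \<Longrightarrow> x(j := g x) \<in> X \<and> f (x(j := g x)) = b"
    and l: "monotone_in I X f l \<or> independent_of I X f l"
  shows "monotone_in (I - {j}) X' g l \<or> independent_of (I - {j}) X' g l"
proof -
  obtain R where R: "R \<in> {(<), (>), (=)}" "rel_in R I X f l"
    using l unfolding monotone_in_def rel_in_simps[symmetric] by blast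
  define Q where "Q = (\<lambda>x y :: real. R y x)"
  have QR: "Q \<in> {(<), (>), (=)}" "(\<lambda>x y. Q y x) \<in> {(<), (>), (=)}"
    using R(1) unfolding Q_def by (auto simp: fun_eq_iff)
  have "\<exists>R\<in>{(<), (>), (=)}. rel_in R (I - {j}) X' g l"
    using mono unfolding monotone_in_def
  proof
    assume "strictly_increasing_in I X f j"
    from rel_in_level_function_increasing[OF I X this X' g R] show ?thesis
      using QR(1) unfolding Q_def by blast
  next
    assume "strictly_decreasing_in I X f j"
    then have inc: "strictly_increasing_in I X (\<lambda>x. - f x) j"
      unfolding strictly_increasing_in_def strictly_decreasing_in_def by simp
    have g': "\<And>x. x \<in> X' \<Longrightarrow> x(j := g x) \<in> X \<and> - f (x(j := g x)) = - b" using g by simp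
    have "rel_in Q I X (\<lambda>x. - f x) l" unfolding Q_def by (rule rel_in_flip[OF R])
    from rel_in_level_function_increasing[OF I X inc X' g' QR(1) this] show ?thesis
      using QR(2) by blast
  qed
  then show ?thesis unfolding monotone_in_def rel_in_simps[symmetric] by blast
qed

section \<open>From level sets back to sublevel sets\<close>

text \<open>Two nearby points of \<open>X\<close> and \<open>C\<close> are joined inside a box
  contained in \<open>X\<close> by changing one coordinate at a time. Only coordinates that vary in
  \<open>C\<close> actually change, and \<open>f\<close> is independent of those. So
  \<open>f\<close> is locally constant on the connected set \<open>X \<inter> C\<close>.\<close>

lemma independent_imp_constant:
  assumes I: "finite I" and X: "cone_connected I X" and C: "coordinate_cone I C"
    and ind: "\<And>j. j \<in> I \<Longrightarrow> independent_of I X f j \<or> (\<exists>t. \<forall>z\<in>C. z j = t)"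
    and zw: "z \<in> X \<inter> C" "w \<in> X \<inter> C"
  shows "f z = f w"
proof -
  have "locally_constant I (X \<inter> C) (\<lambda>x. f x = f w)"
    unfolding locally_constant_def
  proof
    fix x assume x: "x \<in> X \<inter> C"
    then have xX: "x \<in> X" by blast
    have xs: "x \<in> span_of I" using cone_connected_span[OF I X] xX by blast
    obtain e where e: "e > 0" "\<And>w. w \<in> span_of I \<Longrightarrow> near I e x w \<Longrightarrow> w \<in> X"
      using cone_connected_box[OF I X xX] by metis
    have "f y = f x" if y: "y \<in> X \<inter> C" "near I e x y" for y
    proof -
      \<comment> \<open>The intermediate points, with the coordinates in \<open>F\<close> already
        taken from \<open>y\<close>; they lie in the same box around \<open>x\<close> as
        \<open>y\<close>.\<close>
      define h where "h F = (\<lambda>i. if i \<in> F then y i else x i)" for F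
      have hX: "h F \<in> X" if "F \<subseteq> I" for F
      proof (rule e(2))
        show "h F \<in> span_of I" using xs that by (auto simp: h_def PiE_iff extensional_def)
        show "near I e x (h F)" using y(2) e(1) by (auto simp: h_def near_def)
      qed
      have "f (h F) = f x" if "finite F" "F \<subseteq> I" for F
        using that
      proof (induction F)
        case empty
        then show ?case by (simp add: h_def)
      next
        case (insert k F)
        have eq: "h (insert k F) = (h F)(k := y k)" "h F = (h F)(k := x k)"
          using insert.hyps by (auto simp: h_def fun_eq_iff)
        have mem: "(h F)(k := y k) \<in> X" "(h F)(k := x k) \<in> X"
          using hX[of F] hX[of "insert k F"] insert.prems eq by auto
        have "f ((h F)(k := y k)) = f ((h F)(k := x k))"
        proof (cases "x k = y k")
          case False
          have "k \<in> I" using insert.prems by blast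
          moreover have "\<not> (\<exists>t. \<forall>z\<in>C. z k = t)" using False x y(1) by (metis IntE)
          ultimately have "rel_in (=) I X f k" using ind unfolding rel_in_simps by blast
          then show ?thesis
            using rel_in_upd[of "(=)" I X f k "h F"] mem False by (metis linorder_less_linear)
        qed simp
        moreover have "f (h F) = f x" using insert by blast
        ultimately show ?case using eq by metis
      qed
      from this[OF I subset_refl] have "f (h I) = f x" .
      moreover have "y \<in> span_of I" using cone_connected_span[OF I X] y by blast
      then have "h I = y" using xs by (auto simp: h_def fun_eq_iff PiE_iff extensional_def)
      ultimately show ?thesis by simp
    qed
    then show "\<exists>e>0. \<forall>y\<in>X \<inter> C. near I e x y \<longrightarrow> (f y = f w) = (f x = f w)"
      using e(1) by (intro exI[of _ e]) auto
  qed
  from connectedin_spanD[OF I cone_connectedD[OF X C] this zw] show ?thesis by simp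
qed

lemma connectedin_graph:
  assumes I: "finite I" "j \<in> I" and A: "connectedin (powertop_real (I - {j})) A"
    and g: "box_continuous (I - {j}) X' g" "A \<subseteq> X'"
  shows "connectedin (powertop_real I) ((\<lambda>x. x(j := g x)) ` A)"
proof (rule connectedin_spanI[OF I(1)])
  have fin: "finite (I - {j})" using I by blast
  have A': "A \<subseteq> span_of (I - {j})"
    using A unfolding connectedin_span_iff[OF fin] by (rule conjunct1)
  show "(\<lambda>x. x(j := g x)) ` A \<subseteq> span_of I"
    by (intro image_subsetI upd_span[OF _ I(2)] subsetD[OF A'])
  fix P z w
  assume P: "locally_constant I ((\<lambda>x. x(j := g x)) ` A) P"
    and zw: "z \<in> (\<lambda>x. x(j := g x)) ` A" "w \<in> (\<lambda>x. x(j := g x)) ` A" "P z"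
  have "locally_constant (I - {j}) A (\<lambda>x. P (x(j := g x)))"
    unfolding locally_constant_def
  proof
    fix x assume x: "x \<in> A"
    obtain e where e: "e > 0" and near_e: "\<forall>w\<in>(\<lambda>x. x(j := g x)) ` A. near I e (x(j := g x)) w \<longrightarrow>
        P w = P (x(j := g x))"
      using bspec[OF P[unfolded locally_constant_def] imageI[OF x]] by blast
    have Pe: "P (y(j := g y)) = P (x(j := g x))" if "y \<in> A" "near I e (x(j := g x)) (y(j := g y))" for y
      using bspec[OF near_e imageI[OF that(1)]] that(2) by (rule mp)
    obtain d where d: "d > 0" "\<And>y. y \<in> X' \<Longrightarrow> near (I - {j}) d x y \<Longrightarrow> \<bar>g y - g x\<bar> < e"
      using g(1)[unfolded box_continuous_def, rule_format, of x e] g(2) x e by blast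
    have "near I e (x(j := g x)) (y(j := g y))" if "y \<in> A" "near (I - {j}) (min d e) x y" for y
    proof -
      have "near (I - {j}) d x y" "near (I - {j}) e x y"
        using that(2) near_mono by (meson min.cobounded1 min.cobounded2)+
      then show ?thesis using d(2)[of y] that(1) g(2) unfolding near_def by auto
    qed
    then show "\<exists>e>0. \<forall>y\<in>A. near (I - {j}) e x y \<longrightarrow> P (y(j := g y)) = P (x(j := g x))"
      using e d(1) Pe by (intro exI[of _ "min d e"]) auto
  qed
  then have *: "P (x(j := g x)) = P (y(j := g y))" if "x \<in> A" "y \<in> A" for x y
    by (rule connectedin_spanD[OF fin A _ that])
  show "P w"
    using zw(1,2) by (elim imageE) (use * zw(3) in metis)
qed

text \<open>Of the two points to be compared let \<open>v\<close> be the higher one.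
  \<open>P\<close> is constant on the connected level set through \<open>v\<close>, so cutting it
  off there and continuing by the constant \<open>P v\<close> gives a locally constant predicate on
  all of \<open>A\<close>, and \<open>A\<close> is connected.\<close>

lemma connectedin_sublevel:
  assumes I: "finite I" and A: "connectedin (powertop_real I) A" and f: "box_continuous I A f"
    and level: "\<And>b. connectedin (powertop_real I) {x \<in> A. f x = b}"
  shows "connectedin (powertop_real I) {x \<in> A. f x < b}"
proof (rule connectedin_spanI[OF I])
  have "A \<subseteq> span_of I" using A unfolding connectedin_span_iff[OF I] by (rule conjunct1)
  then show "{x \<in> A. f x < b} \<subseteq> span_of I" by blast
  fix P z w assume P: "locally_constant I {x \<in> A. f x < b} P"
    and zw: "z \<in> {x \<in> A. f x < b}" "w \<in> {x \<in> A. f x < b}" "P z"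
  define v where "v = (if f z < f w then w else z)"
  have v: "v \<in> A" "f v < b" "f z \<le> f v" "f w \<le> f v"
    using zw by (auto simp: v_def)
  \<comment> \<open>The continuation of \<open>P\<close> beyond the level of \<open>v\<close>; by
    \<open>Qeq\<close> it still agrees with \<open>P\<close> on that level itself.\<close>
  define Q where "Q x \<longleftrightarrow> (if f x < f v then P x else P v)" for x
  have Qeq: "Q x = P x" if x: "x \<in> A" "f x \<le> f v" for x
  proof (cases "f x < f v")
    case False
    have "P x = P v"
    proof (rule connectedin_spanD[OF I level])
      show "locally_constant I {x \<in> A. f x = f v} P"
        by (rule locally_constant_subset[OF P]) (use v in auto)
    qed (use x v False in auto)
    then show ?thesis by (simp add: Q_def)
  qed (simp add: Q_def)
  have "locally_constant I A Q"
    unfolding locally_constant_def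
  proof
    fix x assume x: "x \<in> A"
    show "\<exists>e>0. \<forall>y\<in>A. near I e x y \<longrightarrow> Q y = Q x"
    proof (cases "f x \<le> f v")
      case True
      then have "x \<in> {x \<in> A. f x < b}" using x v(2) by simp
      from bspec[OF P[unfolded locally_constant_def] this]
      obtain e where e: "e > 0" "\<And>y. y \<in> A \<Longrightarrow> f y < b \<Longrightarrow> near I e x y \<Longrightarrow> P y = P x"
        by auto
      show ?thesis
      proof (cases "f x = f v")
        case True
        have "Q y = Q x" if "y \<in> A" "near I e x y" for y
          using Qeq[of x] Qeq[of y] e(2)[of y] that x True v(2) by (auto simp: Q_def)
        then show ?thesis using e(1) by blast
      next
        case False
        then obtain d where d: "d > 0" "\<And>y. y \<in> A \<Longrightarrow> near I d x y \<Longrightarrow> \<bar>f y - f x\<bar> < f v - f x"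
          using f x True unfolding box_continuous_def by (metis diff_gt_0_iff_gt order_less_le)
        have "Q y = Q x" if "y \<in> A" "near I (min d e) x y" for y
        proof -
          have *: "near I d x y" "near I e x y"
            using that(2) near_mono by (meson min.cobounded1 min.cobounded2)+
          have "f y < f v" "f x < f v" using d(2)[OF that(1) *(1)] False True by linarith+
          then show ?thesis using e(2)[OF that(1) _ *(2)] v(2) by (simp add: Q_def)
        qed
        then show ?thesis using d(1) e(1) by (intro exI[of _ "min d e"]) auto
      qed
    next
      case False
      then obtain d where d: "d > 0" "\<And>y. y \<in> A \<Longrightarrow> near I d x y \<Longrightarrow> \<bar>f y - f x\<bar> < f x - f v"
        using f x unfolding box_continuous_def by (metis diff_gt_0_iff_gt not_le)
      have "Q y = Q x" if "y \<in> A" "near I d x y" for y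
        using d(2)[OF that] False by (auto simp: Q_def)
      then show ?thesis using d(1) by blast
    qed
  qed
  from connectedin_spanD[OF I A this] have "Q z = Q w" using zw by blast
  then show "P w" using Qeq zw v by simp
qed

lemma box_continuous_subset: "box_continuous I X f \<Longrightarrow> A \<subseteq> X \<Longrightarrow> box_continuous I A f"
  unfolding box_continuous_def by (meson subsetD)

text \<open>The graph description is used for a coordinate \<open>j\<close> that the cone does not
  fix and on which \<open>f\<close> depends. The level set inside \<open>C\<close> is then the graph
  of \<open>g\<close> over \<open>{g \<in> D}\<close> cut by a cone in the other coordinates. If
  there is no such \<open>j\<close>, then \<open>f\<close> is constant on
  \<open>X \<inter> C\<close>.\<close>

lemma connectedin_level_cone:
  assumes I: "finite I" and X: "cone_connected I X" and C: "coordinate_cone I C"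
    and graph: "\<And>j. j \<in> I \<Longrightarrow> \<not> independent_of I X f j \<Longrightarrow> {x \<in> X. f x = b} \<noteq> {} \<Longrightarrow>
      \<exists>X' g. X' \<subseteq> span_of (I - {j}) \<and> {x \<in> X. f x = b} = (\<lambda>x. x(j := g x)) ` X' \<and>
        box_continuous (I - {j}) X' g \<and>
        (\<forall>D. half_line D \<longrightarrow> cone_connected (I - {j}) {x \<in> X'. g x \<in> D})"
  shows "connectedin (powertop_real I) {x \<in> X \<inter> C. f x = b}"
proof (cases "{x \<in> X \<inter> C. f x = b} = {}")
  case True
  then show ?thesis by (metis connectedin_empty)
next
  case False
  then obtain z where z: "z \<in> X \<inter> C" "f z = b" by blast
  show ?thesis
  proof (cases "\<forall>j\<in>I. independent_of I X f j \<or> (\<exists>t. \<forall>z\<in>C. z j = t)")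
    case True
    then have "\<And>x. x \<in> X \<inter> C \<Longrightarrow> f x = b"
      using independent_imp_constant[OF I X C _ _ z(1), of f] z(2) by blast
    then have "{x \<in> X \<inter> C. f x = b} = X \<inter> C" by blast
    then show ?thesis using cone_connectedD[OF X C] by simp
  next
    case False
    then obtain j where j: "j \<in> I" "\<not> independent_of I X f j" "\<not> (\<exists>t. \<forall>z\<in>C. z j = t)"
      by blast
    obtain C' D t where C': "coordinate_cone (I - {j}) C'" "half_line D \<or> D = {t}"
      and Ceq: "C = cylinder I j C' D"
      by (rule coordinate_coneE[OF C j(1)])
    \<comment> \<open>An equation for coordinate \<open>j\<close> would fix it on \<open>C\<close>,
      against the choice of \<open>j\<close>.\<close>
    then have D: "half_line D" using j(3) unfolding Ceq cylinder_def by auto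
    obtain X' g where X': "X' \<subseteq> span_of (I - {j})" "{x \<in> X. f x = b} = (\<lambda>x. x(j := g x)) ` X'"
      and g: "box_continuous (I - {j}) X' g"
      and gD: "\<And>D. half_line D \<Longrightarrow> cone_connected (I - {j}) {x \<in> X'. g x \<in> D}"
      using graph[OF j(1,2)] z by blast
    have mem: "x(j := g x) \<in> C \<longleftrightarrow> x \<in> C' \<and> g x \<in> D" if "x \<in> X'" for x
      using that X'(1) restrict_upd_span[of x I j "g x"] upd_span[of x I j "g x"] j(1)
      unfolding Ceq cylinder_def by auto
    have "{x \<in> X \<inter> C. f x = b} = (\<lambda>x. x(j := g x)) ` X' \<inter> C" unfolding X'(2)[symmetric] by blast
    also have "\<dots> = (\<lambda>x. x(j := g x)) ` ({x \<in> X'. g x \<in> D} \<inter> C')" using mem by auto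
    finally show ?thesis
      using connectedin_graph[OF I j(1) cone_connectedD[OF gD[OF D] C'(1)] g] by auto
  qed
qed

lemma cone_connected_sublevel:
  assumes I: "finite I" and X: "cone_connected I X" and f: "box_continuous I X f"
    and level: "\<And>b C. coordinate_cone I C \<Longrightarrow> connectedin (powertop_real I) {x \<in> X \<inter> C. f x = b}"
  shows "cone_connected I {x \<in> X. f x < b}"
  unfolding cone_connected_def
proof (intro conjI allI impI)
  have "upper_semicontinuous_on I X f"
    using f by (simp add: box_continuous_iff_semicontinuous[OF I cone_connected_openin[OF X]])
  then have "openin (subtopology (powertop_real I) X) {x \<in> X. f x < b}"
    by (simp add: upper_semicontinuous_on_def)
  then show "openin (powertop_real I) {x \<in> X. f x < b}"
    using cone_connected_openin[OF X] by (rule openin_trans_full)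
  fix C assume C: "coordinate_cone I C"
  have "connectedin (powertop_real I) {x \<in> X \<inter> C. f x < b}"
    by (rule connectedin_sublevel[OF I cone_connectedD[OF X C] box_continuous_subset[OF f] level[OF C]]) simp
  moreover have "{x \<in> X \<inter> C. f x < b} = {x \<in> X. f x < b} \<inter> C" by blast
  ultimately show "connectedin (powertop_real I) ({x \<in> X. f x < b} \<inter> C)" by simp
qed

section \<open>Strict monotonicity from injectivity on lines\<close>

text \<open>On each line a continuous injective function on an interval is strictly monotone. The
  direction is decided by two points of the line with different values, and by continuity the same
  comparison decides it on all nearby lines; so the direction is locally constant on the connected
  set \<open>X\<close>.\<close>

lemma monotone_in_if_injective_on_lines:
  assumes I: "finite I" "j \<in> I" and X: "cone_connected I X" and f: "box_continuous I X f"
    and inj: "\<And>x a b. x(j := a) \<in> X \<Longrightarrow> x(j := b) \<in> X \<Longrightarrow> f (x(j := a)) = f (x(j := b)) \<Longrightarrow> a = b"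
  shows "monotone_in I X f j"
proof -
  have span: "X \<subseteq> span_of I" by (rule cone_connected_span[OF I(1) X])
  define L where "L x = {s. x(j := s) \<in> X}" for x
  define inc where "inc x \<longleftrightarrow> strict_mono_on (L x) (\<lambda>s. f (x(j := s)))" for x
  have alt: "inc x \<or> strict_antimono_on (L x) (\<lambda>s. f (x(j := s)))" if "x \<in> span_of I" for x
  proof -
    have "is_interval (L x)"
      unfolding is_interval_1 L_def using cone_connected_line[OF I(1) X I(2) that] by blast
    moreover have "continuous_on (L x) (\<lambda>s. f (x(j := s)))"
      unfolding L_def by (rule continuous_on_line[OF f that I(2)])
    moreover have "inj_on (\<lambda>s. f (x(j := s))) (L x)"
      unfolding inj_on_def L_def using inj by blast
    ultimately show ?thesis
      unfolding inc_def using injective_eq_monotone_map by blast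
  qed
  have incI: "inc x" if "x \<in> span_of I" "a \<in> L x" "b \<in> L x" "a < b" "f (x(j := a)) < f (x(j := b))" for x a b
    using alt[OF that(1)] that unfolding monotone_on_def by force
  have incD: "f (x(j := a)) < f (x(j := b))" if "inc x" "a \<in> L x" "b \<in> L x" "a < b" for x a b
    using that unfolding inc_def monotone_on_def by blast
  have "locally_constant I X inc"
    unfolding locally_constant_def
  proof
    fix x assume x: "x \<in> X"
    obtain e where e: "e > 0" "\<And>w. w \<in> span_of I \<Longrightarrow> near I e x w \<Longrightarrow> w \<in> X"
      using cone_connected_box[OF I(1) X x] by metis
    \<comment> \<open>A second point on the line through \<open>x\<close>, chosen halfway inside the
      box so that it remains in \<open>X\<close> after small changes of the other
      coordinates.\<close>
    define t where "t = x j + e / 2"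
    have xt: "x(j := t) \<in> X"
      using e span_upd[OF subsetD[OF span x] I(2)] near_upd[of e t x j I] by (auto simp: t_def)
    have ne: "f (x(j := t)) \<noteq> f x"
      using inj[of x t "x j"] x xt e(1) by (auto simp: t_def)
    \<comment> \<open>Errors below \<open>r\<close> at both ends cannot reverse the sign of the
      difference of the two values.\<close>
    define r where "r = \<bar>f (x(j := t)) - f x\<bar> / 2"
    have r: "r > 0" using ne by (simp add: r_def)
    obtain d1 where d1: "d1 > 0" "\<And>w. w \<in> X \<Longrightarrow> near I d1 x w \<Longrightarrow> \<bar>f w - f x\<bar> < r"
      using f x r unfolding box_continuous_def by blast
    obtain d2 where d2: "d2 > 0" "\<And>w. w \<in> X \<Longrightarrow> near I d2 (x(j := t)) w \<Longrightarrow> \<bar>f w - f (x(j := t))\<bar> < r"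
      using f xt r unfolding box_continuous_def by blast
    \<comment> \<open>The bound \<open>e / 2\<close> ensures both \<open>y j < t\<close> and that
      \<open>y(j := t)\<close> stays in the box around \<open>x\<close>.\<close>
    define d where "d = Min {d1, d2, e / 2}"
    have d: "d > 0" "d \<le> d1" "d \<le> d2" "d \<le> e / 2" using d1(1) d2(1) e(1) by (auto simp: d_def)
    have sign: "inc y \<longleftrightarrow> f x < f (x(j := t))" if y: "y \<in> X" "near I d x y" for y
    proof -
      have ys: "y \<in> span_of I" using span y(1) by blast
      have yt: "y j < t" using y(2) I(2) d(4) e(1) unfolding near_def t_def by fastforce
      have "near I e x (y(j := t))"
        using y(2) d(4) e(1) unfolding near_def t_def by fastforce
      then have ytX: "y(j := t) \<in> X" using e(2) span_upd[OF ys I(2)] by blast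
      have "near I d2 (x(j := t)) (y(j := t))"
        using y(2) d d2(1) unfolding near_def by fastforce
      then have "\<bar>f (y(j := t)) - f (x(j := t))\<bar> < r" using d2(2)[OF ytX] by blast
      moreover have "\<bar>f y - f x\<bar> < r" using d1(2)[OF y(1)] near_mono[OF y(2) d(2)] by blast
      ultimately have "f y < f (y(j := t)) \<longleftrightarrow> f x < f (x(j := t))"
        unfolding r_def by (simp add: abs_if split: if_splits)
      moreover have "inc y \<longleftrightarrow> f y < f (y(j := t))"
        using incI[OF ys, of "y j" t] incD[of y "y j" t] y(1) ytX yt unfolding L_def by auto
      ultimately show ?thesis by blast
    qed
    have "near I d x x" using d(1) by (rule near_refl)
    then show "\<exists>e>0. \<forall>w\<in>X. near I e x w \<longrightarrow> inc w = inc x"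
      using sign d(1) x by blast
  qed
  then have const: "inc x = inc y" if "x \<in> X" "y \<in> X" for x y
    using connectedin_spanD[OF I(1) cone_connectedD[OF X coordinate_cone_UNIV]] that span
    by (simp add: Int_absorb2)
  have incs: "rel_in (<) I X f j" if *: "\<And>x. x \<in> X \<Longrightarrow> inc x"
  proof (rule rel_inI[OF span])
    fix x and a b :: real assume x: "x(j := a) \<in> X" "x(j := b) \<in> X" "a < b"
    then show "f (x(j := a)) < f (x(j := b))"
      using incD[OF *[OF x(1)], of a b] by (simp add: L_def)
  qed
  have decs: "rel_in (>) I X f j" if *: "\<And>x. x \<in> X \<Longrightarrow> \<not> inc x"
  proof (rule rel_inI[OF span])
    fix x and a b :: real assume x: "x(j := a) \<in> X" "x(j := b) \<in> X" "a < b"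
    have "x(j := a) \<in> span_of I" using x(1) span by blast
    then have "strict_antimono_on (L (x(j := a))) (\<lambda>s. f ((x(j := a))(j := s)))"
      using alt *[OF x(1)] by blast
    then show "f (x(j := a)) > f (x(j := b))"
      using x unfolding monotone_on_def L_def by auto
  qed
  show ?thesis
  proof (cases "\<exists>x\<in>X. inc x")
    case True
    then show ?thesis using incs const unfolding monotone_in_def rel_in_simps by blast
  next
    case False
    then show ?thesis using decs unfolding monotone_in_def rel_in_simps by blast
  qed
qed

section \<open>Definable sets\<close>

context o_minimal_structure
begin

lemma full: "{xs. length xs = m} \<in> S m"
  using complement[OF empty, of m] by simp

lemma length_mem: "A \<in> S m \<Longrightarrow> xs \<in> A \<Longrightarrow> length xs = m"
  using subset_power by blast

lemma inter:
  assumes "A \<in> S m" "B \<in> S m"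
  shows "A \<inter> B \<in> S m"
proof -
  have "A \<inter> B = {xs. length xs = m} - (({xs. length xs = m} - A) \<union> ({xs. length xs = m} - B))"
    using length_mem[OF assms(1)] by auto
  then show ?thesis using complement union assms by metis
qed

lemma cylinder_left_append:
  assumes "A \<in> S m"
  shows "{xs @ ys | xs ys. length xs = k \<and> ys \<in> A} \<in> S (k + m)"
proof (induction k)
  case 0
  then show ?case using assms by simp
next
  case (Suc k)
  have "{xs @ ys | xs ys. length xs = Suc k \<and> ys \<in> A} =
      {x # zs | x zs. zs \<in> {xs @ ys | xs ys. length xs = k \<and> ys \<in> A}}"
  proof (intro equalityI subsetI)
    fix zs assume "zs \<in> {xs @ ys | xs ys. length xs = Suc k \<and> ys \<in> A}"
    then obtain xs ys where *: "zs = xs @ ys" "length xs = Suc k" "ys \<in> A" by blast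
    obtain x xs' where "xs = x # xs'" "length xs' = k" using *(2) by (cases xs) auto
    then have "zs = x # (xs' @ ys)" using *(1) by simp
    then show "zs \<in> {x # zs | x zs. zs \<in> {xs @ ys | xs ys. length xs = k \<and> ys \<in> A}}"
      using *(3) \<open>length xs' = k\<close> by blast
  next
    fix zs assume "zs \<in> {x # zs | x zs. zs \<in> {xs @ ys | xs ys. length xs = k \<and> ys \<in> A}}"
    then obtain x xs ys where *: "zs = x # (xs @ ys)" "length xs = k" "ys \<in> A" by blast
    then have "zs = (x # xs) @ ys" "length (x # xs) = Suc k" by auto
    then show "zs \<in> {xs @ ys | xs ys. length xs = Suc k \<and> ys \<in> A}" using *(3) by blast
  qed
  then show ?case using cylinder_left[OF Suc.IH] by simp
qed

lemma cylinder_right_append: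
  assumes "A \<in> S m"
  shows "{xs @ ys | xs ys. length ys = k \<and> xs \<in> A} \<in> S (m + k)"
proof (induction k)
  case 0
  then show ?case using assms by simp
next
  case (Suc k)
  have "{xs @ ys | xs ys. length ys = Suc k \<and> xs \<in> A} =
      {zs @ [x] | x zs. zs \<in> {xs @ ys | xs ys. length ys = k \<and> xs \<in> A}}"
  proof (intro equalityI subsetI)
    fix zs assume "zs \<in> {xs @ ys | xs ys. length ys = Suc k \<and> xs \<in> A}"
    then obtain xs ys where *: "zs = xs @ ys" "length ys = Suc k" "xs \<in> A" by blast
    obtain y ys' where "ys = ys' @ [y]" "length ys' = k" using *(2) by (cases ys rule: rev_cases) auto
    then have "zs = (xs @ ys') @ [y]" using *(1) by simp
    then show "zs \<in> {zs @ [x] | x zs. zs \<in> {xs @ ys | xs ys. length ys = k \<and> xs \<in> A}}"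
      using *(3) \<open>length ys' = k\<close> by blast
  next
    fix zs assume "zs \<in> {zs @ [x] | x zs. zs \<in> {xs @ ys | xs ys. length ys = k \<and> xs \<in> A}}"
    then obtain x xs ys where *: "zs = (xs @ ys) @ [x]" "length ys = k" "xs \<in> A" by blast
    then have "zs = xs @ (ys @ [x])" "length (ys @ [x]) = Suc k" by auto
    then show "zs \<in> {xs @ ys | xs ys. length ys = Suc k \<and> xs \<in> A}" using *(3) by blast
  qed
  then show ?case using cylinder_right[OF Suc.IH] by simp
qed

text \<open>The diagonal axiom equates the first and the last coordinate, so it is applied to the
  block of length \<open>j - i + 1\<close> from position \<open>i\<close> to \<open>j\<close>, which
  is then padded by free coordinates on both sides.\<close>

lemma diagonal_nth_less:
  assumes "i < j" "j < m"
  shows "{xs. length xs = m \<and> xs ! i = xs ! j} \<in> S m"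
proof -
  define E where "E = {ys :: real list. length ys = j - i + 1 \<and> hd ys = last ys}"
  have E: "E \<in> S (j - i + 1)" unfolding E_def by (rule diagonal) simp
  define B where "B = {xs @ ys | xs ys. length xs = i \<and> ys \<in> E}"
  have B: "B \<in> S (i + (j - i + 1))" unfolding B_def by (rule cylinder_left_append[OF E])
  have "{xs @ ys | xs ys. length ys = m - j - 1 \<and> xs \<in> B} \<in> S (i + (j - i + 1) + (m - j - 1))"
    by (rule cylinder_right_append[OF B])
  moreover have "i + (j - i + 1) + (m - j - 1) = m" using assms by simp
  moreover have "{xs @ ys | xs ys. length ys = m - j - 1 \<and> xs \<in> B} = {xs. length xs = m \<and> xs ! i = xs ! j}"
  proof (intro equalityI subsetI)
    fix zs assume "zs \<in> {xs @ ys | xs ys. length ys = m - j - 1 \<and> xs \<in> B}"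
    then obtain xs ys ws where z: "zs = (xs @ ys) @ ws" "length ws = m - j - 1" "length xs = i" "ys \<in> E"
      unfolding B_def by blast
    have ys: "length ys = j - i + 1" "hd ys = last ys" using z(4) unfolding E_def by auto
    then have "ys \<noteq> []" by auto
    then have "ys ! 0 = ys ! (j - i)" using ys by (simp add: hd_conv_nth last_conv_nth)
    moreover have "zs ! i = ys ! 0" "zs ! j = ys ! (j - i)"
      using z ys assms by (auto simp: nth_append)
    ultimately show "zs \<in> {xs. length xs = m \<and> xs ! i = xs ! j}" using z ys assms by simp
  next
    fix zs :: "real list" assume "zs \<in> {xs. length xs = m \<and> xs ! i = xs ! j}"
    then have z: "length zs = m" "zs ! i = zs ! j" by auto
    define ys where "ys = take (j - i + 1) (drop i zs)"
    have ly: "length ys = j - i + 1" using z assms by (simp add: ys_def)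
    have "hd ys = zs ! i" "last ys = zs ! j"
      using ly z assms by (auto simp: hd_conv_nth last_conv_nth ys_def)
    then have "ys \<in> E" using ly z by (simp add: E_def)
    moreover have "zs = (take i zs @ ys) @ drop (j + 1) zs"
    proof -
      have "j + 1 = (j - i + 1) + i" using assms by simp
      then have "ys @ drop (j + 1) zs = drop i zs"
        unfolding ys_def by (metis append_take_drop_id drop_drop)
      then show ?thesis by simp
    qed
    moreover have "length (take i zs) = i" "length (drop (j + 1) zs) = m - j - 1" using z assms by auto
    ultimately show "zs \<in> {xs @ ys | xs ys. length ys = m - j - 1 \<and> xs \<in> B}"
      unfolding B_def by blast
  qed
  ultimately show ?thesis by simp
qed

lemma diagonal_nth:
  assumes "i < m" "j < m"
  shows "{xs. length xs = m \<and> xs ! i = xs ! j} \<in> S m"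
proof (cases i j rule: linorder_cases)
  case less
  then show ?thesis using diagonal_nth_less assms by blast
next
  case equal
  then show ?thesis using full by simp
next
  case greater
  then show ?thesis using diagonal_nth_less[of j i m] assms by (simp add: eq_commute)
qed

lemma projection_take:
  assumes "A \<in> S (k + m)"
  shows "take k ` A \<in> S k"
  using assms
proof (induction m arbitrary: A)
  case 0
  then have "\<And>xs. xs \<in> A \<Longrightarrow> take k xs = xs" using length_mem[OF 0] by simp
  then have "take k ` A = A" by force
  then show ?case using 0 by simp
next
  case (Suc m)
  then have A: "A \<in> S (Suc (k + m))" by simp
  have "take k (butlast xs) = take k xs" if "xs \<in> A" for xs
    using length_mem[OF A that] by (simp add: butlast_conv_take)
  then have "take k ` A = take k ` (butlast ` A)" unfolding image_image by (intro image_cong) auto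
  then show ?case using Suc.IH[OF projection[OF A]] by simp
qed

text \<open>In the product of the full \<open>k\<close>-th power with \<open>A\<close>, impose that
  the \<open>p\<close>-th coordinate of the second factor equals coordinate \<open>js ! p\<close> of
  the first, and project to the first factor. The list \<open>js\<close> may permute, repeat or omit
  coordinates.\<close>

lemma reindex:
  assumes A: "A \<in> S m" and "length js = m" and js: "\<And>p. p \<in> set js \<Longrightarrow> p < k"
  shows "{xs. length xs = k \<and> map ((!) xs) js \<in> A} \<in> S k"
proof -
  define B where "B = {xs @ ys | xs ys. length xs = k \<and> ys \<in> A}"
  have B: "B \<in> S (k + m)" unfolding B_def by (rule cylinder_left_append[OF A])
  \<comment> \<open>The first \<open>r\<close> equations; they are imposed one at a time, each being
    a single diagonal.\<close>
  define G where "G r = B \<inter> {zs. \<forall>p<r. zs ! (js ! p) = zs ! (k + p)}" for r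
  have "G r \<in> S (k + m)" if "r \<le> m" for r
    using that
  proof (induction r)
    case 0
    then show ?case using B by (simp add: G_def)
  next
    case (Suc r)
    have "js ! r < k" using Suc.prems js assms(2) by simp
    then have D: "{zs. length zs = k + m \<and> zs ! (js ! r) = zs ! (k + r)} \<in> S (k + m)"
      using Suc.prems by (intro diagonal_nth) auto
    have "G (Suc r) = G r \<inter> {zs. length zs = k + m \<and> zs ! (js ! r) = zs ! (k + r)}"
      using length_mem[OF B] by (auto simp: G_def less_Suc_eq)
    then show ?case using inter[OF Suc.IH D] Suc.prems by simp
  qed
  then have "take k ` G m \<in> S k" by (intro projection_take) auto
  moreover have "take k ` G m = {xs. length xs = k \<and> map ((!) xs) js \<in> A}"
  proof (intro equalityI subsetI)
    fix xs assume "xs \<in> take k ` G m"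
    then obtain xs' ys where z: "length xs' = k" "ys \<in> A" "xs = take k (xs' @ ys)"
      "\<forall>p<m. (xs' @ ys) ! (js ! p) = (xs' @ ys) ! (k + p)"
      unfolding G_def B_def by blast
    have x: "xs = xs'" using z by simp
    have "map ((!) xs) js = ys"
    proof (rule nth_equalityI)
      show "length (map ((!) xs) js) = length ys" using assms(2) length_mem[OF A z(2)] by simp
      fix p assume p: "p < length (map ((!) xs) js)"
      then have "js ! p < k" using js by simp
      then show "map ((!) xs) js ! p = ys ! p"
        using z(4)[rule_format, of p] p assms(2) x z(1) by (simp add: nth_append)
    qed
    then show "xs \<in> {xs. length xs = k \<and> map ((!) xs) js \<in> A}" using x z by simp
  next
    fix xs assume "xs \<in> {xs. length xs = k \<and> map ((!) xs) js \<in> A}"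
    then have x: "length xs = k" "map ((!) xs) js \<in> A" by auto
    have "xs @ map ((!) xs) js \<in> B" using x unfolding B_def by blast
    moreover have "\<forall>p<m. (xs @ map ((!) xs) js) ! (js ! p) = (xs @ map ((!) xs) js) ! (k + p)"
      using x(1) js assms(2) by (auto simp: nth_append)
    ultimately have "xs @ map ((!) xs) js \<in> G m" unfolding G_def by blast
    then have "take k (xs @ map ((!) xs) js) \<in> take k ` G m" by (rule imageI)
    then show "xs \<in> take k ` G m" using x(1) by simp
  qed
  ultimately show ?thesis by simp
qed

lemma interval_mem: "is_interval J \<Longrightarrow> (\<lambda>x. [x]) ` J \<in> S 1"
  unfolding ominimal by (intro CollectI exI[of _ "{J}"]) simp

section \<open>Definability in labelled coordinates\<close>

lemma change_list:
  assumes "distinct L" "distinct L'" "set L = I" "set L' = I"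
    and A: "(\<lambda>z. map z L) ` A \<in> S (card I)"
  shows "(\<lambda>z. map z L') ` A \<in> S (card I)"
proof -
  have len: "length L = card I" "length L' = card I"
    using assms distinct_card by metis+
  have "\<exists>p<length L'. L' ! p = i" if "i \<in> I" for i
    using that assms(4) by (metis in_set_conv_nth)
  \<comment> \<open>\<open>q i\<close> is the position of the label \<open>i\<close> in
    \<open>L'\<close>.\<close>
  then obtain q where q: "\<And>i. i \<in> I \<Longrightarrow> q i < length L' \<and> L' ! (q i) = i" by metis
  have q': "q (L' ! p) = p" if "p < length L'" for p
    using q[of "L' ! p"] that assms(2,4) nth_mem nth_eq_iff_index_eq by metis
  have "{xs. length xs = card I \<and> map ((!) xs) (map q L) \<in> (\<lambda>z. map z L) ` A} \<in> S (card I)"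
  proof (rule reindex[OF A])
    show "length (map q L) = card I" using len by simp
    show "\<And>p. p \<in> set (map q L) \<Longrightarrow> p < card I" using q assms(3) len by auto
  qed
  moreover have "{xs. length xs = card I \<and> map ((!) xs) (map q L) \<in> (\<lambda>z. map z L) ` A} =
      (\<lambda>z. map z L') ` A"
  proof (intro equalityI subsetI)
    fix xs assume "xs \<in> {xs. length xs = card I \<and> map ((!) xs) (map q L) \<in> (\<lambda>z. map z L) ` A}"
    then obtain z where z: "length xs = card I" "z \<in> A" "map ((!) xs) (map q L) = map z L" by blast
    then have eq: "xs ! q i = z i" if "i \<in> I" for i
      using that assms(3) by (auto simp: map_eq_conv)
    have "xs = map z L'"
    proof (rule nth_equalityI)
      show "length xs = length (map z L')" using z len by simp
      fix p assume p: "p < length xs"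
      then have p': "p < length L'" using z len by simp
      then have "L' ! p \<in> I" using assms(4) by auto
      then show "xs ! p = map z L' ! p" using eq[of "L' ! p"] q'[OF p'] p' by simp
    qed
    then show "xs \<in> (\<lambda>z. map z L') ` A" using z by blast
  next
    fix xs assume "xs \<in> (\<lambda>z. map z L') ` A"
    then obtain z where z: "z \<in> A" "xs = map z L'" by blast
    have "map ((!) xs) (map q L) = map z L" using q assms(3) unfolding z(2) by auto
    then show "xs \<in> {xs. length xs = card I \<and> map ((!) xs) (map q L) \<in> (\<lambda>z. map z L) ` A}"
      using z len by auto
  qed
  ultimately show ?thesis by simp
qed

text \<open>Frees definability from the increasing order of the labels: a coordinate to be added or
  removed can be listed last, wherever its label stands.\<close>

lemma definable_iff_list:
  assumes "distinct L" "set L = I"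
  shows "definable S I A \<longleftrightarrow> A \<subseteq> span_of I \<and> (\<lambda>z. map z L) ` A \<in> S (card I)"
proof -
  have "finite I" using assms(2) by auto
  then have "distinct (sorted_list_of_set I)" "set (sorted_list_of_set I) = I" by auto
  then show ?thesis
    unfolding definable_def using change_list assms by metis
qed

lemma definable_Int:
  assumes "finite I" "definable S I A" "definable S I B"
  shows "definable S I (A \<inter> B)"
proof -
  have "inj_on (\<lambda>z. map z (sorted_list_of_set I)) (span_of I)"
    by (rule inj_onI, rule span_eqI) (use assms(1) in auto)
  then have "(\<lambda>z. map z (sorted_list_of_set I)) ` (A \<inter> B) =
      (\<lambda>z. map z (sorted_list_of_set I)) ` A \<inter> (\<lambda>z. map z (sorted_list_of_set I)) ` B"
    using assms(2,3) unfolding definable_def by (intro inj_on_image_Int) auto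
  then show ?thesis using assms(2,3) inter unfolding definable_def by auto
qed

lemma definable_halfspace:
  assumes I: "finite I" "i \<in> I" and J: "is_interval J"
  shows "definable S I {z \<in> span_of I. z i \<in> J}"
proof -
  let ?L = "sorted_list_of_set I"
  have L: "set ?L = I" "distinct ?L" "length ?L = card I" using I by auto
  then obtain p where p: "p < card I" "?L ! p = i" using I(2) by (metis in_set_conv_nth)
  have "{xs. length xs = card I \<and> map ((!) xs) [p] \<in> (\<lambda>x. [x]) ` J} \<in> S (card I)"
    by (rule reindex[OF interval_mem[OF J]]) (use p in auto)
  moreover have "{xs. length xs = card I \<and> map ((!) xs) [p] \<in> (\<lambda>x. [x]) ` J} =
      (\<lambda>z. map z ?L) ` {z \<in> span_of I. z i \<in> J}"
  proof (intro equalityI subsetI)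
    fix xs assume "xs \<in> {xs. length xs = card I \<and> map ((!) xs) [p] \<in> (\<lambda>x. [x]) ` J}"
    then have x: "length xs = card I" "xs ! p \<in> J" by auto
    define z where "z = (\<lambda>k\<in>I. the (map_of (zip ?L xs) k))"
    have nth: "z (?L ! r) = xs ! r" if "r < card I" for r
    proof -
      have "?L ! r \<in> I" using that L nth_mem by metis
      moreover have "map_of (zip ?L xs) (?L ! r) = Some (xs ! r)"
        using that L x by (intro map_of_zip_nth) auto
      ultimately show ?thesis by (simp add: z_def)
    qed
    have "map z ?L = xs" using nth x L by (intro nth_equalityI) auto
    moreover have "z \<in> {z \<in> span_of I. z i \<in> J}" using nth[OF p(1)] p x by (auto simp: z_def)
    ultimately show "xs \<in> (\<lambda>z. map z ?L) ` {z \<in> span_of I. z i \<in> J}" by blast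
  next
    fix xs assume "xs \<in> (\<lambda>z. map z ?L) ` {z \<in> span_of I. z i \<in> J}"
    then show "xs \<in> {xs. length xs = card I \<and> map ((!) xs) [p] \<in> (\<lambda>x. [x]) ` J}"
      using p L by auto
  qed
  ultimately show ?thesis unfolding definable_def by auto
qed

text \<open>With \<open>j\<close> listed last, forgetting coordinate \<open>j\<close> is
  \<open>butlast\<close>, the projection of the structure.\<close>

lemma definable_restrict:
  assumes I: "finite I" "j \<notin> I" and A: "definable S (insert j I) A"
  shows "definable S I ((\<lambda>z. restrict z I) ` A)"
proof -
  let ?L = "sorted_list_of_set I"
  have "(\<lambda>z. map z (?L @ [j])) ` A \<in> S (card (insert j I))"
    using A definable_iff_list[of "?L @ [j]" "insert j I" A] I by auto
  then have "butlast ` ((\<lambda>z. map z (?L @ [j])) ` A) \<in> S (card I)"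
    using I by (intro projection) simp
  moreover have "butlast ` ((\<lambda>z. map z (?L @ [j])) ` A) = (\<lambda>z. map z ?L) ` ((\<lambda>z. restrict z I) ` A)"
    unfolding image_image using I by (intro image_cong) auto
  ultimately show ?thesis unfolding definable_def by auto
qed

text \<open>Any label outside \<open>I\<close> can serve as value coordinate. In particular a level
  set in the span of \<open>I\<close>, read as a graph with value coordinate \<open>j\<close>, has
  the same definability as the function it defines.\<close>

lemma definable_function_iff:
  assumes I: "finite I" "i \<notin> I" and X: "X \<subseteq> span_of I"
  shows "definable_function S I X f \<longleftrightarrow> definable S (insert i I) ((\<lambda>x. x(i := f x)) ` X)"
proof -
  let ?L = "sorted_list_of_set I"
  have "(\<lambda>z. map z (?L @ [i])) ` ((\<lambda>x. x(i := f x)) ` X) = (\<lambda>x. map x ?L @ [f x]) ` X"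
    unfolding image_image using I by (intro image_cong) auto
  moreover have "(\<lambda>x. x(i := f x)) ` X \<subseteq> span_of (insert i I)"
    using upd_span[of _ "insert i I" i] X I by (intro image_subsetI) auto
  ultimately show ?thesis
    using definable_iff_list[of "?L @ [i]" "insert i I" "(\<lambda>x. x(i := f x)) ` X"] I
    unfolding definable_function_def by simp
qed

text \<open>The preimage is the projection of the part of the graph whose value coordinate lies in
  \<open>J\<close>; a fresh label is available for that coordinate because \<open>I\<close> is
  finite.\<close>

lemma definable_preimage:
  assumes I: "finite I" and X: "X \<subseteq> span_of I" and f: "definable_function S I X f" and J: "is_interval J"
  shows "definable S I {x \<in> X. f x \<in> J}"
proof -
  obtain i where i: "i \<notin> I" using I by (metis ex_new_if_finite infinite_UNIV_nat)
  let ?G = "(\<lambda>x. x(i := f x)) ` X"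
  have "definable S (insert i I) ?G" using definable_function_iff[OF I i X] f by blast
  moreover have "definable S (insert i I) {z \<in> span_of (insert i I). z i \<in> J}"
    by (rule definable_halfspace) (use I J in auto)
  ultimately have "definable S I ((\<lambda>z. restrict z I) ` (?G \<inter> {z \<in> span_of (insert i I). z i \<in> J}))"
    using I i by (intro definable_restrict definable_Int) auto
  moreover have "?G \<inter> {z \<in> span_of (insert i I). z i \<in> J} = (\<lambda>x. x(i := f x)) ` {x \<in> X. f x \<in> J}"
    using X i by (auto simp: PiE_iff extensional_def)
  moreover have "(\<lambda>z. restrict z I) ` ((\<lambda>x. x(i := f x)) ` {x \<in> X. f x \<in> J}) = {x \<in> X. f x \<in> J}"
  proof -
    have "restrict (x(i := f x)) I = x" if "x \<in> X" for x
      using that X i by (auto simp: PiE_iff extensional_def fun_eq_iff)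
    then show ?thesis unfolding image_image by force
  qed
  ultimately show ?thesis by simp
qed

section \<open>Monotone functions and maps\<close>

lemma cone_connected_openin_subtopology:
  "cone_connected I U \<Longrightarrow> U \<subseteq> X \<Longrightarrow> openin (subtopology (powertop_real I) X) U"
  by (rule subset_openin_subtopology[OF cone_connected_openin])

text \<open>Reduces monotonicity to statements about \<open>cone_connected\<close>. Boundedness and
  definability of sub- and superlevel sets follow from those of \<open>X\<close> and
  \<open>f\<close>, and semicontinuity from their openness; supermonotonicity turns into a condition
  on superlevel sets of \<open>f\<close>.\<close>

lemma monotone_function_iff:
  assumes I: "finite I"
  shows "monotone_function S I X f \<longleftrightarrow>
    definable_function S I X f \<and> semi_monotone S I X \<and> X \<noteq> {} \<and> bounded (f ` X) \<and>
    (\<forall>b. cone_connected I {x \<in> X. f x < b}) \<and> (\<forall>b. cone_connected I {x \<in> X. f x > b}) \<and>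
    (\<forall>j\<in>I. monotone_in I X f j \<or> independent_of I X f j)" (is "?L \<longleftrightarrow> ?R")
proof -
  have neg: "{x \<in> X. - f x < b} = {x \<in> X. f x > - b}" for b by auto
  have all_neg: "(\<forall>b. Q (- b)) \<longleftrightarrow> (\<forall>b. Q b)" for Q :: "real \<Rightarrow> bool" by (metis minus_minus)
  have bneg: "bounded ((\<lambda>x. - f x) ` X) \<longleftrightarrow> bounded (f ` X)"
    by (simp add: bounded_iff)
  have semi: "semi_monotone S I {x \<in> X. f x \<in> J} \<longleftrightarrow> cone_connected I {x \<in> X. f x \<in> J}"
    if "definable_function S I X f" "semi_monotone S I X" "is_interval J" for J
  proof -
    have "X \<subseteq> span_of I" "bounded_in_span I X"
      using that(2) cone_connected_span[OF I] unfolding semi_monotone_iff by auto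
    then have "definable S I {x \<in> X. f x \<in> J}" "bounded_in_span I {x \<in> X. f x \<in> J}"
      using definable_preimage[OF I _ that(1,3)] unfolding bounded_in_span_def by blast+
    then show ?thesis unfolding semi_monotone_iff by blast
  qed
  have semi_less: "semi_monotone S I {x \<in> X. f x < b} \<longleftrightarrow> cone_connected I {x \<in> X. f x < b}"
    "semi_monotone S I {x \<in> X. f x > b} \<longleftrightarrow> cone_connected I {x \<in> X. f x > b}"
    if "definable_function S I X f" "semi_monotone S I X" for b
    using semi[OF that, of "{..<b}"] semi[OF that, of "{b<..}"] by (auto simp: is_interval_1)
  have usc: "(\<forall>b. cone_connected I {x \<in> X. f x < b}) \<Longrightarrow> upper_semicontinuous_on I X f"
    "(\<forall>b. cone_connected I {x \<in> X. f x > b}) \<Longrightarrow> upper_semicontinuous_on I X (\<lambda>x. - f x)"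
    unfolding upper_semicontinuous_on_def neg
    by (intro allI cone_connected_openin_subtopology; simp)+
  show ?thesis
  proof
    assume ?L
    then show ?R
      unfolding monotone_function_def supermonotone_def submonotone_def neg
        all_neg[of "\<lambda>b. semi_monotone S I {x \<in> X. f x > b}"] monotone_in_def
      using semi_less by blast
  next
    assume ?R
    then show ?L
      unfolding monotone_function_def supermonotone_def submonotone_def neg bneg
        all_neg[of "\<lambda>b. semi_monotone S I {x \<in> X. f x > b}"] monotone_in_def
      using semi_less usc by blast
  qed
qed

lemma monotone_function_box_continuous:
  assumes I: "finite I" and f: "monotone_function S I X f"
  shows "box_continuous I X f"
proof -
  have "semi_monotone S I X" "upper_semicontinuous_on I X f" "upper_semicontinuous_on I X (\<lambda>x. - f x)"
    using f unfolding monotone_function_def supermonotone_def submonotone_def by blast+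
  then show ?thesis
    using box_continuous_iff_semicontinuous[OF I, of X f] cone_connected_openin
    unfolding semi_monotone_iff by blast
qed

lemma monotone_function_half_line:
  assumes I: "finite I" and f: "monotone_function S I X f" and D: "half_line D"
  shows "cone_connected I {x \<in> X. f x \<in> D}"
proof -
  have "cone_connected I X" "\<And>b. cone_connected I {x \<in> X. f x < b}" "\<And>b. cone_connected I {x \<in> X. f x > b}"
    using f unfolding monotone_function_iff[OF I] semi_monotone_iff by blast+
  then show ?thesis using D unfolding half_line_def by auto
qed

lemma level_set_monotone_function:
  assumes I: "finite I" "j \<in> I" and f: "monotone_function S I X f" and mono: "monotone_in I X f j"
    and ne: "{x \<in> X. f x = b} \<noteq> {}"
  obtains X' g where "X' \<subseteq> span_of (I - {j})" "{x \<in> X. f x = b} = (\<lambda>x. x(j := g x)) ` X'"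
    "monotone_function S (I - {j}) X' g"
proof -
  define G where "G = {x \<in> X. f x = b}"
  define X' where "X' = drop_coord I j G"
  define g where "g x = (THE s. x(j := s) \<in> G)" for x
  have fin: "finite (I - {j})" using I by blast
  note f' = f[unfolded monotone_function_iff[OF I(1)] semi_monotone_iff]
  have X: "cone_connected I X" and sub: "\<And>b. cone_connected I {x \<in> X. f x < b}"
    and super: "\<And>b. cone_connected I {x \<in> X. f x > b}"
    and bd: "bounded_in_span I X" and deff: "definable_function S I X f"
    using f' by blast+
  have span: "X \<subseteq> span_of I" by (rule cone_connected_span[OF I(1) X])
  have G: "G \<subseteq> span_of I" using span unfolding G_def by blast
  have X'span: "X' \<subseteq> span_of (I - {j})" unfolding X'_def drop_coord_eq[OF G I(2)] by blast
  have uniq: "s = t" if "x(j := s) \<in> G" "x(j := t) \<in> G" for x s t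
    using that monotone_in_upd[OF mono, of x s t] unfolding G_def by auto
  have gI: "g x = s" if "x(j := s) \<in> G" for x s
    unfolding g_def by (rule the_equality) (use that uniq in blast)+
  have gG: "x(j := g x) \<in> G" if x: "x \<in> X'" for x
  proof -
    obtain s where "x(j := s) \<in> G" using x unfolding X'_def drop_coord_eq[OF G I(2)] by blast
    then show ?thesis using gI by simp
  qed
  have graph: "G = (\<lambda>x. x(j := g x)) ` X'"
  proof (intro equalityI subsetI)
    fix z assume z: "z \<in> G"
    define x where "x = restrict z (I - {j})"
    have zx: "x(j := z j) = z" using restrict_upd[of z I j "z j"] z G I(2) by (auto simp: x_def)
    then have "g x = z j" using gI[of x "z j"] z by simp
    then have "z = x(j := g x)" using zx by simp
    moreover have "x \<in> X'" unfolding X'_def drop_coord_def x_def by (rule imageI[OF z])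
    ultimately show "z \<in> (\<lambda>x. x(j := g x)) ` X'" by (rule image_eqI)
  next
    fix z assume "z \<in> (\<lambda>x. x(j := g x)) ` X'"
    then show "z \<in> G" by (rule imageE) (simp add: gG)
  qed
  \<comment> \<open>One statement for three purposes: \<open>D = UNIV\<close> gives the domain of
    \<open>g\<close>, the other two kinds of half-line its sublevel and superlevel sets.\<close>
  have half: "cone_connected (I - {j}) {x \<in> X'. g x \<in> D}" if D: "half_line D" for D
  proof -
    have sub': "{x \<in> G. x j \<in> D} \<subseteq> span_of I" using G by blast
    have "{x \<in> X'. g x \<in> D} = drop_coord I j {x \<in> G. x j \<in> D}"
      unfolding X'_def drop_coord_eq[OF G I(2)] drop_coord_eq[OF sub' I(2)] 
      by (intro Collect_cong conj_cong refl iffI; elim exE conjE CollectE) (auto simp: gI)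
    also have "cone_connected (I - {j}) \<dots>"
      unfolding G_def
      by (rule cone_connected_drop_level[OF I X monotone_function_box_continuous[OF I(1) f] sub super mono D])
    finally show ?thesis .
  qed
  have X': "cone_connected (I - {j}) X'"
    using half[of UNIV] by (simp add: half_line_def)
  have ins: "insert j (I - {j}) = I" and nj: "j \<notin> I - {j}" using I by blast+
  have defG: "definable S I G"
    using definable_preimage[OF I(1) span deff, of "{b}"] unfolding G_def by (simp add: is_interval_1)
  have defX': "definable S (I - {j}) X'"
  proof -
    have "definable S (insert j (I - {j})) G" unfolding ins by (rule defG)
    then show ?thesis unfolding X'_def drop_coord_def by (rule definable_restrict[OF fin nj])
  qed
  have defg: "definable_function S (I - {j}) X' g"
    unfolding definable_function_iff[OF fin nj X'span] ins graph[symmetric] by (rule defG)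
  \<comment> \<open>The values of \<open>g\<close> are \<open>j\<close>-coordinates of points of
    \<open>X\<close>, so one bound serves for the domain and the values of \<open>g\<close>.\<close>
  obtain B where B: "\<And>z i. z \<in> X \<Longrightarrow> i \<in> I \<Longrightarrow> \<bar>z i\<bar> \<le> B"
    using bd unfolding bounded_in_span_def by blast
  have BG: "\<bar>z i\<bar> \<le> B" if "z \<in> G" "i \<in> I" for z i
    using B that unfolding G_def by blast
  have "\<bar>x i\<bar> \<le> B" if "x \<in> X'" "i \<in> I - {j}" for x i
    using BG[OF gG[OF that(1)], of i] that(2) by auto
  then have bdX': "bounded_in_span (I - {j}) X'" unfolding bounded_in_span_def by blast
  have "\<bar>g x\<bar> \<le> B" if "x \<in> X'" for x
    using BG[OF gG[OF that] I(2)] by simp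
  then have bdg: "bounded (g ` X')" unfolding bounded_iff by auto
  have "monotone_function S (I - {j}) X' g"
    unfolding monotone_function_iff[OF fin] semi_monotone_iff
  proof (intro conjI allI ballI)
    show "X' \<noteq> {}" using ne graph unfolding G_def by blast
    show "cone_connected (I - {j}) {x \<in> X'. g x < c}" for c
      using half[of "{..<c}"] by (simp add: half_line_def)
    show "cone_connected (I - {j}) {x \<in> X'. g x > c}" for c
      using half[of "{c<..}"] by (simp add: half_line_def)
    fix l assume l: "l \<in> I - {j}"
    have l': "monotone_in I X f l \<or> independent_of I X f l" using f' l by blast
    have gX: "x(j := g x) \<in> X \<and> f (x(j := g x)) = b" if "x \<in> X'" for x
      using gG[OF that] unfolding G_def by simp
    show "monotone_in (I - {j}) X' g l \<or> independent_of (I - {j}) X' g l"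
      by (rule rel_in_level_function[OF I l X mono X' gX l'])
  qed (fact defg X' bdX' defX' bdg)+
  then show thesis using that[OF X'span] graph unfolding G_def by blast
qed

section \<open>Maps with one value coordinate\<close>

lemma graph_of_singleton:
  assumes "X \<subseteq> span_of I" "i \<notin> I"
  shows "graph_of I {i} X f = (\<lambda>x. x(i := f x i)) ` X"
  unfolding graph_of_def
proof (rule image_cong[OF refl])
  fix x assume "x \<in> X"
  then show "merge I {i} (x, f x) = x(i := f x i)"
    using assms PiE_arb[OF subsetD[OF assms(1)]] by (fastforce simp: merge_def fun_eq_iff)
qed

lemma slice_graph_of:
  assumes "X \<subseteq> span_of I" "i \<notin> I"
  shows "slice (I \<union> {i}) i b (graph_of I {i} X f) = {x \<in> X. f x i = b}"
proof -
  have restr: "restrict (x(i := f x i)) (I \<union> {i} - {i}) = x" if "x \<in> X" for x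
    using restrict_upd_span[of x "insert i I" i] that assms by auto
  have "{z \<in> (\<lambda>x. x(i := f x i)) ` X. z i = b} = (\<lambda>x. x(i := f x i)) ` {x \<in> X. f x i = b}"
    by auto
  then show ?thesis
    unfolding slice_def graph_of_singleton[OF assms] using restr by (simp add: image_image)
qed

text \<open>The condition on \<open>extensional\<close> is what remains of mapping into the span of
  \<open>{i}\<close>, the carrier of its topology; everything else concerns the single
  component.\<close>

lemma admissible_map_iff:
  assumes I: "finite I" "i \<notin> I"
  shows "admissible_map S I {i} X f \<longleftrightarrow>
    semi_monotone S I X \<and> X \<noteq> {} \<and> (\<forall>x\<in>X. f x \<in> extensional {i}) \<and>
    box_continuous I X (\<lambda>x. f x i) \<and> bounded ((\<lambda>x. f x i) ` X) \<and>
    definable_function S I X (\<lambda>x. f x i)"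
proof (cases "semi_monotone S I X")
  case True
  then have X: "openin (powertop_real I) X" "X \<subseteq> span_of I"
    using cone_connected_openin cone_connected_span[OF I(1)] unfolding semi_monotone_iff by auto
  have "topspace (subtopology (powertop_real I) X) = X"
    by (rule topspace_subtopology_subset[OF openin_subset[OF X(1)]])
  then have "continuous_map (subtopology (powertop_real I) X) (powertop_real {i}) f \<longleftrightarrow>
      (\<forall>x\<in>X. f x \<in> extensional {i}) \<and> box_continuous I X (\<lambda>x. f x i)"
    unfolding continuous_map_componentwise
    using continuous_map_iff_box_continuous[OF I(1) X(1), of "\<lambda>x. f x i"] by auto
  moreover have "bounded_in_span {i} (f ` X) \<longleftrightarrow> bounded ((\<lambda>x. f x i) ` X)"
    unfolding bounded_in_span_def bounded_iff by simp
  moreover have "definable S (I \<union> {i}) (graph_of I {i} X f) \<longleftrightarrow> definable_function S I X (\<lambda>x. f x i)"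
    unfolding graph_of_singleton[OF X(2) I(2)] definable_function_iff[OF I X(2)] by simp
  ultimately show ?thesis unfolding admissible_map_def using I True by auto
qed (simp add: admissible_map_def)

text \<open>A set of \<open>n - 1\<close> coordinates is \<open>I - {l}\<close> for some \<open>l\<close>, and two distinct points of the
  level set that agree off \<open>l\<close> exist exactly when \<open>f\<close> is independent of \<open>x\<^sub>l\<close>.\<close>
lemma basis_sets_level:
  assumes I: "finite I" "j \<in> I" and f: "monotone_function S I X f"
    and ne: "{x \<in> X. f x = b} \<noteq> {}"
    and graph: "graph_of (I - {j}) {j} X' f' = {x \<in> X. f x = b}"
    and X': "X' \<subseteq> span_of (I - {j})"
  shows "basis_sets (I - {j}) {j} X' f' = {I - {l} | l. l \<in> I \<and> \<not> independent_of I X f l}"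
proof -
  have X: "cone_connected I X" using f unfolding monotone_function_iff[OF I(1)] semi_monotone_iff by blast
  have span: "X \<subseteq> span_of I" by (rule cone_connected_span[OF I(1) X])
  define m where "m x = merge (I - {j}) {j} (x, f' x)" for x
  have image: "m ` X' = {x \<in> X. f x = b}" using graph unfolding graph_of_def m_def .
  have m: "m x = x(j := f' x j)" if "x \<in> X'" for x
    using that PiE_arb[OF subsetD[OF X' that]] I(2) unfolding m_def by (fastforce simp: merge_def fun_eq_iff)
  have inj_m: "inj_on m X'"
  proof (rule inj_on_inverseI)
    fix x assume x: "x \<in> X'"
    show "restrict (m x) (I - {j}) = x"
      unfolding m[OF x] by (rule restrict_upd_span[OF subsetD[OF X' x]])
  qed
  \<comment> \<open>\<open>m\<close> is a bijection from \<open>X'\<close> onto the level set, so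
    injectivity of a choice of coordinates can be tested on the level set.\<close>
  have inj: "inj_on (\<lambda>x. restrict (m x) B) X' \<longleftrightarrow> inj_on (\<lambda>z. restrict z B) {x \<in> X. f x = b}" for B
    using comp_inj_on_iff[OF inj_m, of "\<lambda>z. restrict z B"] unfolding image by (simp add: o_def)
  have key: "inj_on (\<lambda>z. restrict z (I - {l})) {x \<in> X. f x = b} \<longleftrightarrow> \<not> independent_of I X f l"
    if l: "l \<in> I" for l
  proof
    assume inj: "inj_on (\<lambda>z. restrict z (I - {l})) {x \<in> X. f x = b}"
    show "\<not> independent_of I X f l"
    proof
      assume "independent_of I X f l"
      then have ind: "rel_in (=) I X f l" by (simp add: rel_in_simps)
      obtain z where z: "z \<in> X" "f z = b" using ne by blast
      obtain e where e: "e > 0" "\<And>s. \<bar>s - z l\<bar> < e \<Longrightarrow> z(l := s) \<in> X"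
        using cone_connected_shift[OF I(1) X z(1) l] by metis
      \<comment> \<open>Independence keeps this displaced point on the level set, while it agrees
        with \<open>z\<close> off \<open>l\<close>.\<close>
      define w where "w = z(l := z l + e / 2)"
      have w: "w \<in> X" using e by (simp add: w_def)
      have "f z = f w"
        using rel_in_upd[OF ind, of z "z l" "z l + e / 2"] z w e(1) by (simp add: w_def)
      moreover have "restrict z (I - {l}) = restrict w (I - {l})" by (auto simp: w_def)
      ultimately have "z = w" using inj z w unfolding inj_on_def by auto
      then have "z l = w l" by simp
      then show False using e(1) by (simp add: w_def)
    qed
  next
    assume "\<not> independent_of I X f l"
    then have mono: "monotone_in I X f l" using f l unfolding monotone_function_iff[OF I(1)] by blast
    show "inj_on (\<lambda>z. restrict z (I - {l})) {x \<in> X. f x = b}"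
    proof (rule inj_onI)
      fix z w assume zw: "z \<in> {x \<in> X. f x = b}" "w \<in> {x \<in> X. f x = b}"
        and eq: "restrict z (I - {l}) = restrict w (I - {l})"
      have "(restrict z (I - {l}))(l := z l) = z" "(restrict w (I - {l}))(l := w l) = w"
        using restrict_upd[of z I l "z l"] restrict_upd[of w I l "w l"] zw span l by auto
      then show "z = w"
        using monotone_in_upd[OF mono, of "restrict z (I - {l})" "z l" "w l"] zw eq by auto
    qed
  qed
  \<comment> \<open>Needed for \<open>card I - 1\<close> to be a genuine subtraction on the natural
    numbers.\<close>
  have "I \<noteq> {}" using I by blast
  then have card: "card (I - {l}) = card I - 1" if "l \<in> I" for l using that I by simp
  have sub: "(\<exists>l\<in>I. B = I - {l})" if "B \<subseteq> I" "card B = card I - 1" for B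
  proof -
    have "card (I - B) = 1"
      using that I \<open>I \<noteq> {}\<close> card_Diff_subset[of B I] finite_subset[OF that(1)] card_gt_0_iff[of I] by auto
    then obtain l where "I - B = {l}" by (metis card_1_singletonE)
    then show ?thesis using that(1) by (intro bexI[of _ l]) auto
  qed
  have "basis_sets (I - {j}) {j} X' f' =
      {B. B \<subseteq> I \<and> card B = card I - 1 \<and> inj_on (\<lambda>z. restrict z B) {x \<in> X. f x = b}}"
    unfolding basis_sets_def m_def[symmetric] inj using I card[OF I(2)] by (simp add: insert_absorb)
  also have "\<dots> = {I - {l} | l. l \<in> I \<and> \<not> independent_of I X f l}"
  proof (intro equalityI subsetI)
    fix B assume "B \<in> {B. B \<subseteq> I \<and> card B = card I - 1 \<and> inj_on (\<lambda>z. restrict z B) {x \<in> X. f x = b}}"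
    then show "B \<in> {I - {l} | l. l \<in> I \<and> \<not> independent_of I X f l}"
      using sub key by blast
  next
    fix B assume "B \<in> {I - {l} | l. l \<in> I \<and> \<not> independent_of I X f l}"
    then show "B \<in> {B. B \<subseteq> I \<and> card B = card I - 1 \<and> inj_on (\<lambda>z. restrict z B) {x \<in> X. f x = b}}"
      using key card by blast
  qed
  finally show ?thesis .
qed

section \<open>The two implications\<close>

text \<open>The level set is given by a monotone function of one variable fewer, to which the
  induction hypothesis applies; the label \<open>i\<close> is generalised because \<open>j\<close>
  becomes the value coordinate.\<close>

lemma monotone_map_if_monotone_function:
  assumes "finite I" "i \<notin> I" "card I = Suc n" "admissible_map S I {i} X f"
    "monotone_function S I X (\<lambda>x. f x i)"
  shows "monotone_map S I {i} X f"
  using assms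
proof (induction n arbitrary: I i X f)
  case 0
  show ?case
  proof (rule monotone_map.one)
    show "\<forall>k\<in>{i}. monotone_function S I X (\<lambda>x. f x k)" using 0 by blast
  qed (use 0 in simp_all)
next
  case (Suc n)
  note I = Suc.prems(1) and i = Suc.prems(2) and f = Suc.prems(5)
  have X: "cone_connected I X" using f unfolding monotone_function_iff[OF I] semi_monotone_iff by blast
  have span: "X \<subseteq> span_of I" by (rule cone_connected_span[OF I X])
  show ?case
  proof (rule monotone_map.many)
    show "card I > 1" using Suc.prems by simp
    show "admissible_map S I {i} X f" by (rule Suc.prems)
    have level: "\<exists>X' f'. graph_of (I - {j}) {j} X' f' = {x \<in> X. f x i = b} \<and>
          monotone_map S (I - {j}) {j} X' f' \<and>
          basis_sets (I - {j}) {j} X' f' = {I - {l} | l. l \<in> I \<and> \<not> independent_of I X (\<lambda>x. f x i) l}"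
      if j: "j \<in> I" "\<not> independent_of I X (\<lambda>x. f x i) j" and ne: "{x \<in> X. f x i = b} \<noteq> {}" for j b
    proof -
      have mono: "monotone_in I X (\<lambda>x. f x i) j"
        using f j unfolding monotone_function_iff[OF I] by blast
      obtain X' g where X': "X' \<subseteq> span_of (I - {j})" "{x \<in> X. f x i = b} = (\<lambda>x. x(j := g x)) ` X'"
        and g: "monotone_function S (I - {j}) X' g"
        by (rule level_set_monotone_function[OF I j(1) f mono ne])
      \<comment> \<open>The restriction to \<open>{j}\<close> makes the values extensional, as maps
        into the span require.\<close>
      define f' where "f' x = (\<lambda>_\<in>{j}. g x)" for x
      have fin: "finite (I - {j})" "j \<notin> I - {j}" using I by auto
      have f'j: "(\<lambda>x. f' x j) = g" by (simp add: f'_def)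
      have graph: "graph_of (I - {j}) {j} X' f' = {x \<in> X. f x i = b}"
        unfolding graph_of_singleton[OF X'(1) fin(2)] X'(2) by (simp add: f'_def)
      have "admissible_map S (I - {j}) {j} X' f'"
        unfolding admissible_map_iff[OF fin] f'j
        using g[unfolded monotone_function_iff[OF fin(1)]] monotone_function_box_continuous[OF fin(1) g]
        by (auto simp: f'_def)
      then have "monotone_map S (I - {j}) {j} X' f'"
        using Suc.IH[OF fin, of X' f'] Suc.prems(3) j(1) I g f'j by simp
      then show ?thesis
        using graph basis_sets_level[OF I j(1) f ne graph X'(1)] by blast
    qed
    show "\<forall>i'\<in>{i}. \<forall>j\<in>I. \<not> independent_of I X (\<lambda>x. f x i') j \<longrightarrow>
         (\<exists>\<B>. \<forall>b. slice (I \<union> {i}) i' b (graph_of I {i} X f) \<noteq> {} \<longrightarrow>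
            (\<exists>X' f'.
               graph_of (I - {j}) (insert j ({i} - {i'})) X' f' =
                 slice (I \<union> {i}) i' b (graph_of I {i} X f) \<and>
               monotone_map S (I - {j}) (insert j ({i} - {i'})) X' f' \<and>
               basis_sets (I - {j}) (insert j ({i} - {i'})) X' f' = \<B>))"
    proof (intro ballI impI)
      fix i' j assume "i' \<in> {i}" and j: "j \<in> I" "\<not> independent_of I X (\<lambda>x. f x i') j"
      then have i': "i' = i" by simp
      have single: "insert j ({i} - {i}) = {j}" by simp
      \<comment> \<open>The witness is the system computed in \<open>basis_sets_level\<close>, an
        expression in which \<open>b\<close> does not occur.\<close>
      show "\<exists>\<B>. \<forall>b. slice (I \<union> {i}) i' b (graph_of I {i} X f) \<noteq> {} \<longrightarrow>
            (\<exists>X' f'.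
               graph_of (I - {j}) (insert j ({i} - {i'})) X' f' =
                 slice (I \<union> {i}) i' b (graph_of I {i} X f) \<and>
               monotone_map S (I - {j}) (insert j ({i} - {i'})) X' f' \<and>
               basis_sets (I - {j}) (insert j ({i} - {i'})) X' f' = \<B>)"
        unfolding i' single slice_graph_of[OF span i]
        by (intro exI[of _ "{I - {l} | l. l \<in> I \<and> \<not> independent_of I X (\<lambda>x. f x i) l}"] allI impI
            level j(1) j(2)[unfolded i'])
    qed
  qed
qed

text \<open>Connected level sets give sublevel sets for \<open>f\<close> and, applied to
  \<open>- f\<close>, superlevel sets. Monotonicity in \<open>x_j\<close> comes from injectivity on
  lines, because a graph over the other coordinates contains at most one point of each line in
  direction \<open>j\<close>.\<close>

lemma monotone_function_if_level_sets:
  assumes I: "finite I" "i \<notin> I" and f: "admissible_map S I {i} X f"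
    and level: "\<And>j b. j \<in> I \<Longrightarrow> \<not> independent_of I X (\<lambda>x. f x i) j \<Longrightarrow> {x \<in> X. f x i = b} \<noteq> {} \<Longrightarrow>
      \<exists>X' g. X' \<subseteq> span_of (I - {j}) \<and> {x \<in> X. f x i = b} = (\<lambda>x. x(j := g x)) ` X' \<and>
        monotone_function S (I - {j}) X' g"
  shows "monotone_function S I X (\<lambda>x. f x i)"
proof -
  let ?f = "\<lambda>x. f x i"
  note f' = f[unfolded admissible_map_iff[OF I]]
  have X: "cone_connected I X" and cont: "box_continuous I X ?f"
    using f' unfolding semi_monotone_iff by blast+
  have span: "X \<subseteq> span_of I" by (rule cone_connected_span[OF I(1) X])
  have fin: "finite (I - {j})" for j using I by blast
  have conn: "connectedin (powertop_real I) {x \<in> X \<inter> C. ?f x = b}" if "coordinate_cone I C" for b C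
  proof (rule connectedin_level_cone[OF I(1) X that])
    fix j assume j: "j \<in> I" "\<not> independent_of I X ?f j" "{x \<in> X. ?f x = b} \<noteq> {}"
    obtain X' g where *: "X' \<subseteq> span_of (I - {j})" "{x \<in> X. f x i = b} = (\<lambda>x. x(j := g x)) ` X'"
      "monotone_function S (I - {j}) X' g"
      using level[OF j] by metis
    have "\<forall>D. half_line D \<longrightarrow> cone_connected (I - {j}) {x \<in> X'. g x \<in> D}"
      using monotone_function_half_line[OF fin *(3)] by blast
    then show "\<exists>X' g. X' \<subseteq> span_of (I - {j}) \<and> {x \<in> X. ?f x = b} = (\<lambda>x. x(j := g x)) ` X' \<and>
        box_continuous (I - {j}) X' g \<and>
        (\<forall>D. half_line D \<longrightarrow> cone_connected (I - {j}) {x \<in> X'. g x \<in> D})"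
      using * monotone_function_box_continuous[OF fin *(3)] by blast
  qed
  have sub: "cone_connected I {x \<in> X. ?f x < b}" for b
    by (rule cone_connected_sublevel[OF I(1) X cont conn])
  have "connectedin (powertop_real I) {x \<in> X \<inter> C. - ?f x = b}" if "coordinate_cone I C" for b C
  proof -
    have "{x \<in> X \<inter> C. - ?f x = b} = {x \<in> X \<inter> C. ?f x = - b}" by auto
    then show ?thesis using conn[OF that] by simp
  qed
  then have "cone_connected I {x \<in> X. - ?f x < b}" for b
    using cone_connected_sublevel[OF I(1) X, of "\<lambda>x. - ?f x"] cont by (simp add: box_continuous_minus)
  from this[of "- b" for b] have super: "cone_connected I {x \<in> X. ?f x > b}" for b
    by simp
  have "monotone_in I X ?f j \<or> independent_of I X ?f j" if j: "j \<in> I" for j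
  proof (rule disjCI)
    assume nind: "\<not> independent_of I X ?f j"
    show "monotone_in I X ?f j"
    proof (rule monotone_in_if_injective_on_lines[OF I(1) j X cont])
      fix x and a b :: real
      assume x: "x(j := a) \<in> X" "x(j := b) \<in> X" "?f (x(j := a)) = ?f (x(j := b))"
      define c where "c = ?f (x(j := a))"
      have mem: "x(j := a) \<in> {y \<in> X. ?f y = c}" "x(j := b) \<in> {y \<in> X. ?f y = c}"
        using x by (simp_all add: c_def)
      then have "{y \<in> X. ?f y = c} \<noteq> {}" by (metis empty_iff)
      from level[OF j nind this] obtain X' g where X': "X' \<subseteq> span_of (I - {j})"
        and eq: "{y \<in> X. ?f y = c} = (\<lambda>x. x(j := g x)) ` X'"
        by (elim exE conjE)
      \<comment> \<open>The coordinates off \<open>j\<close> do not involve \<open>s\<close>, and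
        they determine the point of the graph, including its height.\<close>
      have restr: "x(j := s) = (restrict x (I - {j}))(j := g (restrict x (I - {j})))"
        if "x(j := s) \<in> (\<lambda>x. x(j := g x)) ` X'" for s
        using that
      proof (rule imageE)
        fix y assume y: "x(j := s) = y(j := g y)" "y \<in> X'"
        have "restrict (y(j := g y)) (I - {j}) = y"
          by (rule restrict_upd_span[OF subsetD[OF X' y(2)]])
        moreover have "restrict (x(j := s)) (I - {j}) = restrict x (I - {j})" by (auto simp: restrict_def)
        ultimately have "restrict x (I - {j}) = y" using y(1) by simp
        then show ?thesis using y(1) by simp
      qed
      have "x(j := a) = x(j := b)"
        using restr[of a] restr[of b] mem unfolding eq by simp
      then show "a = b" by (metis fun_upd_same)
    qed
  qed
  then show ?thesis
    unfolding monotone_function_iff[OF I(1)] using f' sub super by blast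
qed

text \<open>\<open>K = {i}\<close> is a separate premise with arbitrary \<open>i\<close>, since rule
  induction passes from value coordinate \<open>i\<close> to value coordinate
  \<open>j\<close>.\<close>

lemma monotone_function_if_monotone_map:
  assumes "monotone_map S I K X f" "K = {i}"
  shows "monotone_function S I X (\<lambda>x. f x i)"
  using assms
proof (induction arbitrary: i rule: monotone_map.induct)
  case (one I K X f)
  then show ?case by simp
next
  case (many I K X f)
  then have K: "K = {i}" and adm: "admissible_map S I {i} X f" by auto
  then have I: "finite I" "i \<notin> I" unfolding admissible_map_def by auto
  have "semi_monotone S I X" using adm unfolding admissible_map_def by blast
  then have span: "X \<subseteq> span_of I"
    using cone_connected_span[OF I(1)] unfolding semi_monotone_iff by blast
  show ?case
  proof (rule monotone_function_if_level_sets[OF I adm])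
    fix j b assume j: "j \<in> I" "\<not> independent_of I X (\<lambda>x. f x i) j" "{x \<in> X. f x i = b} \<noteq> {}"
    have "insert j ({i} - {i}) = {j}" by simp
    then obtain X' f' where graph: "graph_of (I - {j}) {j} X' f' = {x \<in> X. f x i = b}"
      and mm: "monotone_map S (I - {j}) {j} X' f'" and mf: "monotone_function S (I - {j}) X' (\<lambda>x. f' x j)"
      using many(3)[unfolded K, rule_format, of i j] j slice_graph_of[OF span I(2), of b f] by (metis singletonI)
    have fin: "finite (I - {j})" using I by blast
    have X': "X' \<subseteq> span_of (I - {j})"
      using mf cone_connected_span[OF fin] unfolding monotone_function_iff[OF fin] semi_monotone_iff by blast
    have eq: "{x \<in> X. f x i = b} = (\<lambda>x. x(j := f' x j)) ` X'"
      using graph graph_of_singleton[OF X', of j f'] by simp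
    show "\<exists>X' g. X' \<subseteq> span_of (I - {j}) \<and> {x \<in> X. f x i = b} = (\<lambda>x. x(j := g x)) ` X' \<and>
        monotone_function S (I - {j}) X' g"
      by (intro exI[of _ X'] exI[of _ "\<lambda>x. f' x j"] conjI X' eq mf)
  qed
qed

end

theorem theorem3p8:
  fixes S :: "nat \<Rightarrow> real list set set" and n :: nat
    and X :: "(nat \<Rightarrow> real) set" and f1 :: "(nat \<Rightarrow> real) \<Rightarrow> real"
  assumes "o_minimal_structure S"
    and "n \<ge> 1"
    and "semi_monotone S {..<n} X" and "X \<noteq> {}"
    and "definable_function S {..<n} X f1"
    and "continuous_map (subtopology (powertop_real {..<n}) X) euclideanreal f1"
    and "bounded (f1 ` X)"
  shows "monotone_map S {..<n} {n} X (\<lambda>x. \<lambda>i\<in>{n}. f1 x) \<longleftrightarrow>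
         monotone_function S {..<n} X f1"
proof -
  interpret o_minimal_structure S by fact
  let ?f = "\<lambda>x. \<lambda>i\<in>{n}. f1 x"
  have f: "(\<lambda>x. ?f x n) = f1" by simp
  have I: "finite {..<n}" "n \<notin> {..<n}" by auto
  have "openin (powertop_real {..<n}) X"
    using assms(3) cone_connected_openin unfolding semi_monotone_iff by blast
  then have "box_continuous {..<n} X f1"
    using continuous_map_iff_box_continuous[OF I(1)] assms(6) by blast
  then have "admissible_map S {..<n} {n} X ?f"
    unfolding admissible_map_iff[OF I] f using assms by simp
  moreover obtain m where "n = Suc m" using assms(2) by (cases n) auto
  ultimately show ?thesis
    using monotone_map_if_monotone_function[OF I, of m X ?f] monotone_function_if_monotone_map[of "{..<n}" "{n}" X ?f n]
    unfolding f by auto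
qed

end
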